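(* Let $(\Omega,\mu)$ be a $\sigma$-finite measure space, $1<p<+\infty$, $q=\frac{p}{p-1}$, $\hat p:=\max\{p,2\}$, $\hat q:=\min\{q,2\}$, and assume that $L^q(\Omega,\mu;\mathbb{C})$ admits an LP decomposition $\mathcal{P}=\{P_j\}_{j=0}^\infty\subset B(L^q(\Omega,\mu;\mathbb{C}))$; write $F^t_q:=F^t_q(\mathcal{P})$ for $t\ge 0$. Let $T:D(T)\to Y$, $y$, $x^*$ and the $x^*$-minimum norm solution $x^\dagger\in D(T)$ of $T(x)=y$ be as in the context. Suppose that there exist a concave index function $\Psi_0:(0,+\infty)\to(0,+\infty)$ and a constant $\theta\ge 0$ such that $$\|x^\dagger-x\|_{(F^\theta_q)^*}\lesssim \Psi_0(\|T(x^\dagger)-T(x)\|_Y)\qquad \forall\, x\in D(T),$$ where the implicit constant is independent of $x$. Moreover, assume that $f^\dagger:=J_{\hat p}(x^\dagger-x^* )$ is nonzero and belongs to $F^{s\theta}_q$ for some $0<s\le 1$. Then, for all sufficiently large $C>0$, the function $\Psi:(0,+\infty)\to(0,+\infty)$ defined by $$\Psi(\delta):=\begin{cases} C\,\|f^\dagger\|_{F^\theta_q}\,\Psi_0(\delta) & \text{if } s=1,\\[4pt] \displaystyle C\inf_{\lambda\ge 1}\left[\frac{1}{2^{\lambda\hat q s}}\|f^\dagger\|_{F^{s\theta}_q}^{\hat q}+2^{(\lambda+1)(1-s)}\|f^\dagger\|_{F^{s\theta}_q}\Psi_0(\delta)\right] & \text{if } s\in(0,1),\end{cases}$$ is a concave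 index function, and the variational source condition $$\langle x^\dagger-x,\,J_{\hat p}(x^\dagger-x^* )\rangle_{p,q}\le \frac{c_p-\beta}{\hat p}\|x-x^\dagger\|_p^{\hat p}+\Psi(\|T(x)-T(x^\dagger)\|_Y)\qquad\forall\, x\in D(T)$$ holds true with $\beta=\frac{c_p}{2}$. Furthermore, $\Psi$ satisfies $$\Psi(\delta)\lesssim \Psi_0(\delta)^{\frac{\hat q s}{1+(\hat q-1)s}}$$ for all sufficiently small $\delta>0$, with implicit constant independent of $\delta$.
   Context: Notation. $L^p(\Omega,\mu)$ and $L^p(\Omega,\mu;\mathbb{C})$ are the real and complex Lebesgue spaces with norm $\|\cdot\|_p$. For $f\in L^p(\Omega,\mu;\mathbb{C})$, $g\in L^q(\Omega,\mu;\mathbb{C})$, $\langle f,g\rangle_{p,q}:=\int_\Omega f\overline g\,d\mu$. $B(X)$ is the space of bounded linear operators on $X$. For nonnegative quantities, $a\lesssim b$ means $a\le Cb$ for a constant $C>0$ independent of $a$ and $b$. Setting. $Y$ is a real or complex Banach space, $D(T)\subset L^p(\Omega,\mu)$ is closed and convex, $T:D(T)\to Y$ is weakly sequentially continuous, $y$ lies in the range of $T$, and $x^*\in L^p(\Omega,\mu)$ is a fixed a priori guess. $x^\dagger\in D(T)$ is an $x^*$-minimum norm solution of $T(x)=y$, i.e. $T(x^\dagger)=y$ and $\|x^\dagger-x^*\|_p=\min\{\|x-x^*\|_p : x\in D(T),\ T(x)=y\}$. Index function. A function $\Psi:(0,+\infty)\to(0,+\infty)$ is an index function if it is continuous, strictly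 increasing and $\lim_{\delta\to0^+}\Psi(\delta)=0$. Index functions are extended by $\Psi(0):=0$ where needed. Duality map and $c_p$. $J_{\hat p}:L^p(\Omega,\mu)\to L^q(\Omega,\mu)$ is the generalized duality map, $J_{\hat p}(w)=\|w\|_p^{\hat p-p}|w|^{p-2}w$ (equal to $0$ where $w=0$), which satisfies $\langle w,J_{\hat p}(w)\rangle_{p,q}=\|w\|_p^{\hat p}$ and $\|J_{\hat p}(w)\|_q=\|w\|_p^{\hat p-1}$. The constant $c_p>0$ is a fixed constant (which exists by $\hat p$-uniform convexity of $L^p(\Omega,\mu)$) such that $$\|w+v\|_p^{\hat p}\ge\|w\|_p^{\hat p}+\hat p\langle v,J_{\hat p}(w)\rangle_{p,q}+c_p\|v\|_p^{\hat p}\qquad\forall\, w,v\in L^p(\Omega,\mu).$$ LP decomposition. $L^q(\Omega,\mu;\mathbb{C})$ admits an LP (Littlewood-Paley) decomposition if there is a family of uniformly bounded and pairwise commuting linear operators $\{P_j\}_{j=0}^\infty\subset B(L^q(\Omega,\mu;\mathbb{C}))$ such that: (i) $z=\sum_{j=0}^\infty P_jz$ for all $z\in L^q(\Omega,\mu;\mathbb{C})$; (ii) $P_jP_kz=0$ for all $z$ and all $j,k\in\mathbb{N}\cup\{0\}$ with $|j-k|\ge2$; (iii) there is a constant $c^*\ge1$ with $\frac1{c^*}\|z\|_q\le\big\|\big(\sum_{j=0}^\infty|P_jz|^2\big)^{1/2}\big\|_q\le c^*\|z\|_q$ for all $z\in L^q(\Omega,\mu;\mathbb{C})$. Spaces.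 For $t\ge0$, $F^t_q(\mathcal{P}):=\{z\in L^q(\Omega,\mu;\mathbb{C}) : \|z\|_{F^t_q(\mathcal{P})}:=\|(\sum_{j=0}^\infty2^{2jt}|P_jz|^2)^{1/2}\|_q<+\infty\}$, a Banach space densely and continuously embedded in $L^q(\Omega,\mu;\mathbb{C})$. Accordingly $L^p(\Omega,\mu;\mathbb{C})$ embeds continuously into the dual $(F^t_q)^*$ via the pairing $\langle\cdot,\cdot\rangle_{p,q}$, so that for $f\in L^p(\Omega,\mu;\mathbb{C})$, $\|f\|_{(F^t_q)^*}=\sup\{|\langle f,g\rangle_{p,q}| : g\in F^t_q,\ \|g\|_{F^t_q}\le1\}$. *)

theory Defs
  imports "HOL-Analysis.Analysis"
begin

text \<open>
  Elements of Lebesgue spaces are represented by functions; equality in the Lebesgue space is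
  equality almost everywhere. Operators and sets are therefore defined on representatives.
\<close>

definition Lp :: "real \<Rightarrow> 'a measure \<Rightarrow> ('a \<Rightarrow> 'b::{real_normed_vector, second_countable_topology}) set"
  where "Lp p M = {f \<in> borel_measurable M. integrable M (\<lambda>\<omega>. norm (f \<omega>) powr p)}"

definition Lp_norm :: "real \<Rightarrow> 'a measure \<Rightarrow> ('a \<Rightarrow> 'b::{real_normed_vector, second_countable_topology}) \<Rightarrow> real"
  where "Lp_norm p M f = (\<integral>\<omega>. norm (f \<omega>) powr p \<partial>M) powr (1 / p)"

definition pairing :: "'a measure \<Rightarrow> ('a \<Rightarrow> complex) \<Rightarrow> ('a \<Rightarrow> complex) \<Rightarrow> complex"
  where "pairing M f g = (\<integral>\<omega>. f \<omega> * cnj (g \<omega>) \<partial>M)"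

definition real_pairing :: "'a measure \<Rightarrow> ('a \<Rightarrow> real) \<Rightarrow> ('a \<Rightarrow> real) \<Rightarrow> real"
  where "real_pairing M f g = (\<integral>\<omega>. f \<omega> * g \<omega> \<partial>M)"

definition Lp_tendsto :: "real \<Rightarrow> 'a measure \<Rightarrow>
    (nat \<Rightarrow> 'a \<Rightarrow> 'b::{real_normed_vector, second_countable_topology}) \<Rightarrow> ('a \<Rightarrow> 'b) \<Rightarrow> bool"
  where "Lp_tendsto p M u f \<longleftrightarrow> (\<lambda>n. Lp_norm p M (\<lambda>\<omega>. u n \<omega> - f \<omega>)) \<longlonglongrightarrow> 0"

text \<open>A set that is closed in this sense is saturated with respect to equality almost everywhere.\<close>

definition Lp_closed :: "real \<Rightarrow> 'a measure \<Rightarrow> ('a \<Rightarrow> real) set \<Rightarrow> bool"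
  where "Lp_closed p M D \<longleftrightarrow> D \<subseteq> Lp p M \<and>
    (\<forall>u f. (\<forall>n. u n \<in> D) \<and> f \<in> Lp p M \<and> Lp_tendsto p M u f \<longrightarrow> f \<in> D)"

definition Lp_convex :: "('a \<Rightarrow> real) set \<Rightarrow> bool"
  where "Lp_convex D \<longleftrightarrow>
    (\<forall>f\<in>D. \<forall>g\<in>D. \<forall>r\<in>{0..1}. (\<lambda>\<omega>. (1 - r) * f \<omega> + r * g \<omega>) \<in> D)"

definition Lp_dual :: "real \<Rightarrow> 'a measure \<Rightarrow> (('a \<Rightarrow> real) \<Rightarrow> real) set"
  where "Lp_dual p M = {\<phi>.
    (\<forall>f\<in>Lp p M. \<forall>g\<in>Lp p M. \<forall>a b. \<phi> (\<lambda>\<omega>. a * f \<omega> + b * g \<omega>) = a * \<phi> f + b * \<phi> g) \<and>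
    (\<exists>K. \<forall>f\<in>Lp p M. \<bar>\<phi> f\<bar> \<le> K * Lp_norm p M f)}"

definition Lp_weakly_tendsto :: "real \<Rightarrow> 'a measure \<Rightarrow> (nat \<Rightarrow> 'a \<Rightarrow> real) \<Rightarrow> ('a \<Rightarrow> real) \<Rightarrow> bool"
  where "Lp_weakly_tendsto p M u f \<longleftrightarrow> (\<forall>\<phi>\<in>Lp_dual p M. (\<lambda>n. \<phi> (u n)) \<longlonglongrightarrow> \<phi> f)"

text \<open>
  For a complex Banach space, weak convergence agrees with weak convergence in the underlying real
  Banach space, the real functionals being the real parts of the complex ones. Testing with real
  functionals thus covers both scalar fields.
\<close>

definition weakly_tendsto :: "(nat \<Rightarrow> 'y::real_normed_vector) \<Rightarrow> 'y \<Rightarrow> bool"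
  where "weakly_tendsto u y \<longleftrightarrow>
    (\<forall>\<phi> :: 'y \<Rightarrow> real. bounded_linear \<phi> \<longrightarrow> (\<lambda>n. \<phi> (u n)) \<longlonglongrightarrow> \<phi> y)"

text \<open>
  The first conjunct says that \<open>T\<close> is well defined on equivalence classes; it also follows from
  the second one.
\<close>

definition weakly_seq_continuous ::
    "real \<Rightarrow> 'a measure \<Rightarrow> ('a \<Rightarrow> real) set \<Rightarrow> (('a \<Rightarrow> real) \<Rightarrow> 'y::real_normed_vector) \<Rightarrow> bool"
  where "weakly_seq_continuous p M D T \<longleftrightarrow>
    (\<forall>f\<in>D. \<forall>g\<in>D. (AE \<omega> in M. f \<omega> = g \<omega>) \<longrightarrow> T f = T g) \<and>
    (\<forall>u f. (\<forall>n. u n \<in> D) \<and> f \<in> D \<and> Lp_weakly_tendsto p M u f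
       \<longrightarrow> weakly_tendsto (\<lambda>n. T (u n)) (T f))"

definition min_norm_solution ::
    "real \<Rightarrow> 'a measure \<Rightarrow> ('a \<Rightarrow> real) set \<Rightarrow> (('a \<Rightarrow> real) \<Rightarrow> 'y) \<Rightarrow> 'y \<Rightarrow> ('a \<Rightarrow> real) \<Rightarrow> ('a \<Rightarrow> real) \<Rightarrow> bool"
  where "min_norm_solution p M D T y xstar x \<longleftrightarrow> x \<in> D \<and> T x = y \<and>
    (\<forall>x'\<in>D. T x' = y \<longrightarrow>
       Lp_norm p M (\<lambda>\<omega>. x \<omega> - xstar \<omega>) \<le> Lp_norm p M (\<lambda>\<omega>. x' \<omega> - xstar \<omega>))"

definition index_function :: "(real \<Rightarrow> real) \<Rightarrow> bool"
  where "index_function \<Psi> \<longleftrightarrow> (\<forall>\<delta>>0. \<Psi> \<delta> > 0) \<and> continuous_on {0<..} \<Psi> \<and>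
    strict_mono_on {0<..} \<Psi> \<and> (\<Psi> \<longlongrightarrow> 0) (at_right 0)"

definition concave_index_function :: "(real \<Rightarrow> real) \<Rightarrow> bool"
  where "concave_index_function \<Psi> \<longleftrightarrow> index_function \<Psi> \<and> concave_on {0<..} \<Psi>"

definition extend0 :: "(real \<Rightarrow> real) \<Rightarrow> real \<Rightarrow> real"
  where "extend0 \<Psi> \<delta> = (if \<delta> = 0 then 0 else \<Psi> \<delta>)"

text \<open>Where \<open>w \<omega> = 0\<close> or \<open>w\<close> vanishes almost everywhere, \<open>0 powr a = 0\<close> gives the value zero.\<close>

definition duality_map :: "real \<Rightarrow> real \<Rightarrow> 'a measure \<Rightarrow> ('a \<Rightarrow> real) \<Rightarrow> 'a \<Rightarrow> real"
  where "duality_map r p M w \<omega> =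
    Lp_norm p M w powr (r - p) * \<bar>w \<omega>\<bar> powr (p - 2) * w \<omega>"

definition uniform_convexity_constant :: "real \<Rightarrow> real \<Rightarrow> 'a measure \<Rightarrow> real \<Rightarrow> bool"
  where "uniform_convexity_constant r p M c \<longleftrightarrow> c > 0 \<and>
    (\<forall>w\<in>Lp p M. \<forall>v\<in>Lp p M.
       Lp_norm p M (\<lambda>\<omega>. w \<omega> + v \<omega>) powr r \<ge>
         Lp_norm p M w powr r + r * real_pairing M v (duality_map r p M w) + c * Lp_norm p M v powr r)"

definition Lp_bounded_operator :: "real \<Rightarrow> 'a measure \<Rightarrow> (('a \<Rightarrow> complex) \<Rightarrow> 'a \<Rightarrow> complex) \<Rightarrow> bool"
  where "Lp_bounded_operator q M A \<longleftrightarrow>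
    (\<forall>f\<in>Lp q M. A f \<in> Lp q M) \<and>
    (\<forall>f\<in>Lp q M. \<forall>g\<in>Lp q M. (AE \<omega> in M. f \<omega> = g \<omega>) \<longrightarrow> (AE \<omega> in M. A f \<omega> = A g \<omega>)) \<and>
    (\<forall>f\<in>Lp q M. \<forall>g\<in>Lp q M. \<forall>a b.
       AE \<omega> in M. A (\<lambda>\<omega>'. a * f \<omega>' + b * g \<omega>') \<omega> = a * A f \<omega> + b * A g \<omega>) \<and>
    (\<exists>K. \<forall>f\<in>Lp q M. Lp_norm q M (A f) \<le> K * Lp_norm q M f)"

text \<open>
  The square functions below may take the value infinity, so their norms are formed with values in
  the extended nonnegative reals. Only positive exponents occur.
\<close>

definition ennpowr :: "ennreal \<Rightarrow> real \<Rightarrow> ennreal"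
  where "ennpowr x a = (if x = \<infinity> then \<infinity> else ennreal (enn2real x powr a))"

definition eLp_norm :: "real \<Rightarrow> 'a measure \<Rightarrow> ('a \<Rightarrow> ennreal) \<Rightarrow> ennreal"
  where "eLp_norm q M g = ennpowr (\<integral>\<^sup>+\<omega>. ennpowr (g \<omega>) q \<partial>M) (1 / q)"

definition F_enorm :: "real \<Rightarrow> 'a measure \<Rightarrow> (nat \<Rightarrow> ('a \<Rightarrow> complex) \<Rightarrow> 'a \<Rightarrow> complex) \<Rightarrow>
    real \<Rightarrow> ('a \<Rightarrow> complex) \<Rightarrow> ennreal"
  where "F_enorm q M P t z =
    eLp_norm q M (\<lambda>\<omega>. ennpowr (\<Sum>j. ennreal (2 powr (2 * real j * t) * (cmod (P j z \<omega>))\<^sup>2)) (1 / 2))"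

definition LP_decomposition ::
    "real \<Rightarrow> 'a measure \<Rightarrow> (nat \<Rightarrow> ('a \<Rightarrow> complex) \<Rightarrow> 'a \<Rightarrow> complex) \<Rightarrow> bool"
  where "LP_decomposition q M P \<longleftrightarrow>
    (\<forall>j. Lp_bounded_operator q M (P j)) \<and>
    (\<exists>K. \<forall>j. \<forall>z\<in>Lp q M. Lp_norm q M (P j z) \<le> K * Lp_norm q M z) \<and>
    (\<forall>j k. \<forall>z\<in>Lp q M. AE \<omega> in M. P j (P k z) \<omega> = P k (P j z) \<omega>) \<and>
    (\<forall>z\<in>Lp q M. Lp_tendsto q M (\<lambda>n \<omega>. \<Sum>j<n. P j z \<omega>) z) \<and>
    (\<forall>j k. \<bar>int j - int k\<bar> \<ge> 2 \<longrightarrow> (\<forall>z\<in>Lp q M. AE \<omega> in M. P j (P k z) \<omega> = 0)) \<and>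
    (\<exists>c\<ge>1. \<forall>z\<in>Lp q M.
       ennreal (1 / c * Lp_norm q M z)
         \<le> eLp_norm q M (\<lambda>\<omega>. ennpowr (\<Sum>j. ennreal ((cmod (P j z \<omega>))\<^sup>2)) (1 / 2)) \<and>
       eLp_norm q M (\<lambda>\<omega>. ennpowr (\<Sum>j. ennreal ((cmod (P j z \<omega>))\<^sup>2)) (1 / 2))
         \<le> ennreal (c * Lp_norm q M z))"

definition F_space :: "real \<Rightarrow> 'a measure \<Rightarrow> (nat \<Rightarrow> ('a \<Rightarrow> complex) \<Rightarrow> 'a \<Rightarrow> complex) \<Rightarrow>
    real \<Rightarrow> ('a \<Rightarrow> complex) set"
  where "F_space q M P t = {z \<in> Lp q M. F_enorm q M P t z < \<infinity>}"

definition F_norm :: "real \<Rightarrow> 'a measure \<Rightarrow> (nat \<Rightarrow> ('a \<Rightarrow> complex) \<Rightarrow> 'a \<Rightarrow> complex) \<Rightarrow>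
    real \<Rightarrow> ('a \<Rightarrow> complex) \<Rightarrow> real"
  where "F_norm q M P t z = enn2real (F_enorm q M P t z)"

text \<open>
  For \<open>f\<close> in \<open>Lp p M\<close> with \<open>p\<close> conjugate to \<open>q\<close> and \<open>t \<ge> 0\<close>, the supremum is over a set that is
  nonempty (take \<open>g = 0\<close>) and bounded, by Hoelder's inequality and the embedding of the space with
  index \<open>t\<close> into \<open>Lp q M\<close>; so the real-valued supremum is the intended one.
\<close>

definition F_dual_norm :: "real \<Rightarrow> 'a measure \<Rightarrow> (nat \<Rightarrow> ('a \<Rightarrow> complex) \<Rightarrow> 'a \<Rightarrow> complex) \<Rightarrow>
    real \<Rightarrow> ('a \<Rightarrow> complex) \<Rightarrow> real"
  where "F_dual_norm q M P t f =
    (SUP g\<in>{g \<in> F_space q M P t. F_norm q M P t g \<le> 1}. cmod (pairing M f g))"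

end

theory Submission
  imports Defs
begin

text \<open>
  For \<open>f = J(x\<^sup>\<dagger> - x*)\<close> the low-frequency part \<open>S\<^sub>m f\<close>, the sum of the \<open>P\<^sub>j f\<close> with
  \<open>j \<le> m\<close>, has norm at most a multiple of \<open>2\<^bsup>m\<theta>(1 - s)\<^esup>\<close> in the space of index \<open>\<theta>\<close>, while
  \<open>f - S\<^sub>m f\<close> has norm at most a multiple of \<open>2\<^bsup>- m\<theta>s\<^esup>\<close> in the Lebesgue space: by almost
  orthogonality, away from \<open>j = m, m + 1\<close> the components of either part are those of \<open>f\<close> or zero.
  The pairing of \<open>x\<^sup>\<dagger> - x\<close> with the first part is controlled by the conditional stability estimate,
  and its pairing with the second one by Hoelder's and Young's inequalities, which absorb
  \<open>x\<^sup>\<dagger> - x\<close> into the norm term. Taking \<open>m\<theta>\<close> close to \<open>\<lambda>\<close> gives the bound for every \<open>\<lambda> \<ge> 1\<close>. As a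
  function of \<open>\<Psi>0 \<delta>\<close> the infimum over \<open>\<lambda>\<close> is one of affine functions with slopes bounded away from 0, hence
  concave and strictly increasing, and balancing the two summands in \<open>\<lambda>\<close> gives the rate.
\<close>

section \<open>Lebesgue norms\<close>

lemma ennpowr_ennreal: "0 \<le> x \<Longrightarrow> ennpowr (ennreal x) a = ennreal (x powr a)"
  by (simp add: ennpowr_def)

lemma ennpowr_top [simp]: "ennpowr top a = top"
  by (simp add: ennpowr_def)

lemma ennpowr_mono: "x \<le> y \<Longrightarrow> 0 \<le> a \<Longrightarrow> ennpowr x a \<le> ennpowr y a"
  by (cases x; cases y) (auto simp: ennpowr_ennreal intro!: ennreal_leI powr_mono2 simp: top_unique)

lemma ennpowr_mult:
  assumes "0 \<le> c" "a > 0"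
  shows "ennpowr (ennreal c * x) a = ennreal (c powr a) * ennpowr x a"
proof (cases "c = 0")
  case True
  then show ?thesis using ennpowr_ennreal[of 0 a] by simp
next
  case False
  then show ?thesis using assms
    by (cases x) (auto simp: ennpowr_ennreal powr_mult ennreal_mult[symmetric] ennreal_mult_top)
qed

text \<open>Replacing the sum by twice the larger summand works for exponents below and above 1
  alike; the loss is harmless in estimates up to constants.\<close>

lemma ennpowr_add_le:
  assumes "a > 0"
  shows "ennpowr (x + y) a \<le> ennreal (2 powr a) * (ennpowr x a + ennpowr y a)"
proof -
  have "x + y \<le> ennreal 2 * max x y"
    using add_mono[OF max.cobounded1[of x y] max.cobounded2[of y x]] by (simp add: mult_2)
  then have "ennpowr (x + y) a \<le> ennpowr (ennreal 2 * max x y) a"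
    using assms by (intro ennpowr_mono) auto
  also have "\<dots> = ennreal (2 powr a) * ennpowr (max x y) a"
    using assms by (intro ennpowr_mult) auto
  also have "ennpowr (max x y) a \<le> ennpowr x a + ennpowr y a"
    by (simp add: max_def)
  finally show ?thesis by (simp add: mult_left_mono)
qed

lemma ennpowr_half_add_le: "ennpowr (x + y) (1/2) \<le> ennpowr x (1/2) + ennpowr y (1/2)"
proof (cases "x = top \<or> y = top")
  case False
  then obtain a b where "x = ennreal a" "0 \<le> a" "y = ennreal b" "0 \<le> b"
    by (cases x; cases y) auto
  then show ?thesis
    by (simp add: ennpowr_ennreal ennreal_plus[symmetric] powr_half_sqrt sqrt_add_le_add_sqrt
        del: ennreal_plus)
qed auto

lemma ennpowr_half_square: "0 \<le> a \<Longrightarrow> ennpowr (ennreal (a\<^sup>2)) (1/2) = ennreal a"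
  by (simp add: ennpowr_ennreal powr_half_sqrt)

lemma ennpowr_measurable [measurable (raw)]:
  assumes [measurable]: "f \<in> borel_measurable M"
  shows "(\<lambda>x. ennpowr (f x) a) \<in> borel_measurable M"
  unfolding ennpowr_def by measurable

section \<open>Monotonicity, homogeneity and triangle inequality of Lebesgue norms\<close>

lemma eLp_norm_mono_AE:
  assumes "AE \<omega> in M. g \<omega> \<le> h \<omega>" "q > 0"
  shows "eLp_norm q M g \<le> eLp_norm q M h"
  unfolding eLp_norm_def using assms
  by (intro ennpowr_mono nn_integral_mono_AE) (auto elim!: AE_mp intro!: ennpowr_mono)

lemma eLp_norm_cmult:
  assumes "g \<in> borel_measurable M" "0 \<le> c" "q > 0"
  shows "eLp_norm q M (\<lambda>\<omega>. ennreal c * g \<omega>) = ennreal c * eLp_norm q M g"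
  unfolding eLp_norm_def using assms
  by (simp add: ennpowr_mult nn_integral_cmult powr_powr)

text \<open>The constant 4 replaces that of Minkowski's inequality: the sum is split once inside the
  integral with exponent \<open>q\<close> and once outside with exponent \<open>1/q\<close>, and
  \<open>2 * 2 powr (1/q)\<close> is at most 4.\<close>

lemma eLp_norm_add_le:
  assumes [measurable]: "g \<in> borel_measurable M" "h \<in> borel_measurable M" and q: "q \<ge> 1"
  shows "eLp_norm q M (\<lambda>\<omega>. g \<omega> + h \<omega>) \<le> 4 * (eLp_norm q M g + eLp_norm q M h)"
proof -
  let ?I = "\<lambda>g. \<integral>\<^sup>+\<omega>. ennpowr (g \<omega>) q \<partial>M"
  have "?I (\<lambda>\<omega>. g \<omega> + h \<omega>) \<le> (\<integral>\<^sup>+\<omega>. ennreal (2 powr q) * (ennpowr (g \<omega>) q + ennpowr (h \<omega>) q) \<partial>M)"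
    using q by (intro nn_integral_mono ennpowr_add_le) auto
  also have "\<dots> = ennreal (2 powr q) * (?I g + ?I h)"
    by (simp add: nn_integral_cmult nn_integral_add)
  finally have "ennpowr (?I (\<lambda>\<omega>. g \<omega> + h \<omega>)) (1/q) \<le> ennpowr (ennreal (2 powr q) * (?I g + ?I h)) (1/q)"
    using q by (intro ennpowr_mono) auto
  also have "\<dots> = 2 * ennpowr (?I g + ?I h) (1/q)"
    using q by (subst ennpowr_mult) (auto simp: powr_powr)
  also have "ennpowr (?I g + ?I h) (1/q) \<le> ennreal (2 powr (1/q)) * (ennpowr (?I g) (1/q) + ennpowr (?I h) (1/q))"
    using q by (intro ennpowr_add_le) auto
  also have "ennreal (2 powr (1/q)) \<le> 2"
    using powr_mono[of "1/q" 1 2] q ennreal_leI by fastforce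
  finally show ?thesis
    unfolding eLp_norm_def by (simp add: mult_left_mono mult_right_mono mult.assoc[symmetric])
qed

lemma Lp_iff_enorm:
  assumes "q > 0"
  shows "f \<in> Lp q M \<longleftrightarrow> f \<in> borel_measurable M \<and> eLp_norm q M (\<lambda>\<omega>. ennreal (norm (f \<omega>))) < \<infinity>"
proof (cases "f \<in> borel_measurable M")
  case True
  note [measurable] = True
  have "ennpowr x (1 / q) < \<infinity> \<longleftrightarrow> x < \<infinity>" for x
    by (auto simp: ennpowr_def less_top)
  then show ?thesis
    by (auto simp: Lp_def eLp_norm_def integrable_iff_bounded ennpowr_ennreal)
qed (simp add: Lp_def)

lemma eLp_norm_eq_Lp_norm:
  assumes "f \<in> Lp q M"
  shows "eLp_norm q M (\<lambda>\<omega>. ennreal (norm (f \<omega>))) = ennreal (Lp_norm q M f)"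
  using assms by (simp add: Lp_def eLp_norm_def Lp_norm_def ennpowr_ennreal nn_integral_eq_integral)

lemma Lp_norm_nonneg [simp]: "0 \<le> Lp_norm q M f"
  by (simp add: Lp_norm_def)

lemma Lp_measurable [measurable_dest]: "f \<in> Lp q M \<Longrightarrow> f \<in> borel_measurable M"
  by (simp add: Lp_def)

lemma Lp_norm_eq_0_imp_AE:
  assumes "f \<in> Lp q M" "Lp_norm q M f = 0"
  shows "AE \<omega> in M. f \<omega> = 0"
proof -
  have "(\<integral>\<omega>. norm (f \<omega>) powr q \<partial>M) = 0"
    using assms(2) by (simp add: Lp_norm_def)
  then have "AE \<omega> in M. norm (f \<omega>) powr q = 0"
    using assms(1) by (subst (asm) integral_nonneg_eq_0_iff_AE) (auto simp: Lp_def)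
  then show ?thesis by simp
qed

lemma Lp_add:
  assumes "f \<in> Lp q M" "g \<in> Lp q M" "q \<ge> 1"
  shows "(\<lambda>\<omega>. f \<omega> + g \<omega>) \<in> Lp q M"
    and "Lp_norm q M (\<lambda>\<omega>. f \<omega> + g \<omega>) \<le> 4 * (Lp_norm q M f + Lp_norm q M g)"
proof -
  note [measurable] = assms(1,2)
  have "eLp_norm q M (\<lambda>\<omega>. ennreal (norm (f \<omega> + g \<omega>)))
      \<le> eLp_norm q M (\<lambda>\<omega>. ennreal (norm (f \<omega>)) + ennreal (norm (g \<omega>)))"
    using assms(3) by (intro eLp_norm_mono_AE AE_I2)
      (auto simp: ennreal_plus[symmetric] norm_triangle_ineq simp del: ennreal_plus)
  also have "\<dots> \<le> 4 * (eLp_norm q M (\<lambda>\<omega>. ennreal (norm (f \<omega>))) + eLp_norm q M (\<lambda>\<omega>. ennreal (norm (g \<omega>))))"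
    using assms(3) by (intro eLp_norm_add_le) auto
  also have "\<dots> = ennreal (4 * (Lp_norm q M f + Lp_norm q M g))"
    using assms by (simp add: eLp_norm_eq_Lp_norm ennreal_mult)
  finally have *: "eLp_norm q M (\<lambda>\<omega>. ennreal (norm (f \<omega> + g \<omega>))) \<le> ennreal (4 * (Lp_norm q M f + Lp_norm q M g))" .
  then show L: "(\<lambda>\<omega>. f \<omega> + g \<omega>) \<in> Lp q M"
    using assms(3) by (simp add: Lp_iff_enorm le_less_trans)
  show "Lp_norm q M (\<lambda>\<omega>. f \<omega> + g \<omega>) \<le> 4 * (Lp_norm q M f + Lp_norm q M g)"
    using * unfolding eLp_norm_eq_Lp_norm[OF L] by (subst (asm) ennreal_le_iff) auto
qed

lemma Lp_cmult:
  fixes f :: "'a \<Rightarrow> 'b::{real_normed_field, second_countable_topology}"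
  assumes "f \<in> Lp q M"
  shows "(\<lambda>\<omega>. c * f \<omega>) \<in> Lp q M"
  using assms by (auto simp: Lp_def norm_mult powr_mult)

lemma Lp_diff:
  fixes f :: "'a \<Rightarrow> 'b::{real_normed_field, second_countable_topology}"
  assumes "f \<in> Lp q M" "g \<in> Lp q M" "q \<ge> 1"
  shows "(\<lambda>\<omega>. f \<omega> - g \<omega>) \<in> Lp q M"
  using Lp_add(1)[OF assms(1) Lp_cmult[OF assms(2), of "-1"] assms(3)] by simp

lemma Lp_of_real:
  assumes "f \<in> Lp p M"
  shows "(\<lambda>\<omega>. complex_of_real (f \<omega>)) \<in> Lp p M"
proof -
  note [measurable] = Lp_measurable[OF assms]
  have "(\<lambda>\<omega>. complex_of_real (f \<omega>)) \<in> borel_measurable M"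
    by measurable
  then show ?thesis using assms by (simp add: Lp_def)
qed

lemma Lp_zero [simp]: "(\<lambda>\<omega>. 0) \<in> Lp q M"
  by (simp add: Lp_def)

lemma Lp_sum:
  assumes "\<And>i. i \<in> I \<Longrightarrow> f i \<in> Lp q M" "q \<ge> 1"
  shows "(\<lambda>\<omega>. \<Sum>i\<in>I. f i \<omega>) \<in> Lp q M"
  using assms by (induction I rule: infinite_finite_induct) (auto intro!: Lp_add)

text \<open>Iterating the triangle inequality costs a factor 4 per term. The constant grows with the
  number of terms, so the bound serves for the few neighbours of an index, not for whole
  series.\<close>

lemma Lp_norm_sum_le:
  assumes "finite I" "\<And>i. i \<in> I \<Longrightarrow> f i \<in> Lp q M" "q \<ge> 1"
  shows "Lp_norm q M (\<lambda>\<omega>. \<Sum>i\<in>I. f i \<omega>) \<le> 4 ^ card I * (\<Sum>i\<in>I. Lp_norm q M (f i))"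
  using assms(1,2)
proof (induction I rule: finite_induct)
  case empty
  then show ?case by (simp add: Lp_norm_def)
next
  case (insert i I)
  let ?N = "Lp_norm q M (f i)" and ?S = "\<Sum>k\<in>I. Lp_norm q M (f k)"
  have fi: "f i \<in> Lp q M" and fI: "\<And>k. k \<in> I \<Longrightarrow> f k \<in> Lp q M"
    using insert.prems by auto
  have IH: "Lp_norm q M (\<lambda>\<omega>. \<Sum>k\<in>I. f k \<omega>) \<le> 4 ^ card I * ?S"
    using insert.IH fI by blast
  have "Lp_norm q M (\<lambda>\<omega>. f i \<omega> + (\<Sum>k\<in>I. f k \<omega>))
      \<le> 4 * (?N + Lp_norm q M (\<lambda>\<omega>. \<Sum>k\<in>I. f k \<omega>))"
    by (rule Lp_add(2)[OF fi Lp_sum[OF fI assms(3)] assms(3)])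
  also have "\<dots> \<le> 4 * (4 ^ card I * ?N + 4 ^ card I * ?S)"
    using IH mult_right_mono[of 1 "4 ^ card I" ?N] by simp
  also have "\<dots> = 4 ^ card (insert i I) * (?N + ?S)"
    using insert.hyps by (simp add: distrib_left)
  finally show ?case using insert.hyps by simp
qed

lemma Lp_norm_cong_AE:
  assumes "f \<in> borel_measurable M" "g \<in> borel_measurable M" "AE \<omega> in M. f \<omega> = g \<omega>"
  shows "Lp_norm q M f = Lp_norm q M g"
  unfolding Lp_norm_def using assms
  by (intro arg_cong[where f = "\<lambda>x. x powr (1/q)"] integral_cong_AE) (auto elim!: AE_mp)

section \<open>The inequalities of Hoelder and Young\<close>

lemma Holder_inequality:
  fixes f g :: "'a \<Rightarrow> complex"
  assumes pq: "p > 1" "q > 1" "1/p + 1/q = 1" and f: "f \<in> Lp p M" and g: "g \<in> Lp q M"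
  shows "integrable M (\<lambda>\<omega>. f \<omega> * cnj (g \<omega>))"
    and "cmod (pairing M f g) \<le> Lp_norm p M f * Lp_norm q M g"
proof -
  note [measurable] = f g
  have cnj_g [measurable]: "(\<lambda>\<omega>. cnj (g \<omega>)) \<in> borel_measurable M"
    by (rule measurable_compose[OF _ borel_measurable_continuous_onI[OF continuous_on_cnj]])
      (auto intro: continuous_intros)
  have fp: "integrable M (\<lambda>\<omega>. norm (f \<omega>) powr p)" and ig: "integrable M (\<lambda>\<omega>. norm (g \<omega>) powr q)"
    using f g by (auto simp: Lp_def)
  \<comment> \<open>Young's inequality, applied pointwise, supplies an integrable majorant.\<close>
  show int: "integrable M (\<lambda>\<omega>. f \<omega> * cnj (g \<omega>))"
  proof (rule Bochner_Integration.integrable_bound)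
    show "integrable M (\<lambda>\<omega>. norm (f \<omega>) powr p / p + norm (g \<omega>) powr q / q)"
      using fp ig by auto
    show "AE \<omega> in M. norm (f \<omega> * cnj (g \<omega>)) \<le> norm (norm (f \<omega>) powr p / p + norm (g \<omega>) powr q / q)"
      using Youngs_inequality[OF pq] pq by (intro AE_I2) (simp add: norm_mult)
  qed measurable
  \<comment> \<open>For the product bound Young's inequality is applied to the functions divided by
    their norms, so a vanishing norm has to be treated separately.\<close>
  let ?a = "Lp_norm p M f" and ?b = "Lp_norm q M g"
  show "cmod (pairing M f g) \<le> ?a * ?b"
  proof (cases "?a = 0 \<or> ?b = 0")
    case True
    then have "(AE \<omega> in M. f \<omega> = 0) \<or> (AE \<omega> in M. g \<omega> = 0)"
      using f g Lp_norm_eq_0_imp_AE by blast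
    then have "AE \<omega> in M. f \<omega> * cnj (g \<omega>) = 0"
      by (auto elim: AE_mp)
    then have "pairing M f g = 0"
      unfolding pairing_def using int by (subst integral_cong_AE[where g = "\<lambda>_. 0"]) auto
    then show ?thesis by simp
  next
    case False
    then have ab: "?a > 0" "?b > 0"
      using Lp_norm_nonneg[of p M f] Lp_norm_nonneg[of q M g] by linarith+
    have ap: "?a powr p = (\<integral>\<omega>. norm (f \<omega>) powr p \<partial>M)" "?b powr q = (\<integral>\<omega>. norm (g \<omega>) powr q \<partial>M)"
      using pq by (auto simp: Lp_norm_def powr_powr)
    have "cmod (pairing M f g) \<le> (\<integral>\<omega>. norm (f \<omega> * cnj (g \<omega>)) \<partial>M)"
      unfolding pairing_def by (rule integral_norm_bound)
    also have "\<dots> \<le> (\<integral>\<omega>. ?a * ?b * (norm (f \<omega>) powr p / (?a powr p * p) + norm (g \<omega>) powr q / (?b powr q * q)) \<partial>M)"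
    proof (rule integral_mono)
      show "norm (f \<omega> * cnj (g \<omega>)) \<le> ?a * ?b * (norm (f \<omega>) powr p / (?a powr p * p) + norm (g \<omega>) powr q / (?b powr q * q))" for \<omega>
      proof -
        have "norm (f \<omega> * cnj (g \<omega>)) = ?a * ?b * ((norm (f \<omega>) / ?a) * (norm (g \<omega>) / ?b))"
          using ab by (simp add: norm_mult)
        also have "\<dots> \<le> ?a * ?b * ((norm (f \<omega>) / ?a) powr p / p + (norm (g \<omega>) / ?b) powr q / q)"
          using ab by (intro mult_left_mono Youngs_inequality pq) auto
        finally show ?thesis using ab by (simp add: powr_divide)
      qed
    qed (use int fp ig in auto)
    also have "\<dots> = ?a * ?b * (1 / p + 1 / q)"
      using fp ig ab by (simp add: ap[symmetric])
    finally show ?thesis using pq by simp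
  qed
qed

lemma pairing_of_real:
  "pairing M (\<lambda>\<omega>. complex_of_real (f \<omega>)) (\<lambda>\<omega>. complex_of_real (g \<omega>)) = of_real (real_pairing M f g)"
proof -
  have "(\<lambda>\<omega>. complex_of_real (f \<omega>) * cnj (complex_of_real (g \<omega>))) = (\<lambda>\<omega>. complex_of_real (f \<omega> * g \<omega>))"
    by simp
  then show ?thesis unfolding pairing_def real_pairing_def by (simp only: integral_complex_of_real)
qed

text \<open>Young's inequality for \<open>e powr (1/p) * a\<close> and
  \<open>e powr (- 1/p) * b\<close>. The free weight \<open>e\<close> prescribes the coefficient of
  \<open>a powr p\<close>, which is what allows this term to be absorbed later.\<close>

lemma Youngs_inequality_eps:
  fixes a b e p q :: real
  assumes "p > 1" "q > 1" "1/p + 1/q = 1" "0 \<le> a" "0 \<le> b" "0 < e"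
  shows "a * b \<le> e / p * a powr p + e powr (- q / p) / q * b powr q"
proof -
  have "a * b = (e powr (1/p) * a) * (e powr (- 1/p) * b)"
    using assms by (simp add: powr_minus field_simps)
  also have "\<dots> \<le> (e powr (1/p) * a) powr p / p + (e powr (- 1/p) * b) powr q / q"
    using assms by (intro Youngs_inequality) auto
  also have "\<dots> = e / p * a powr p + e powr (- q / p) / q * b powr q"
    using assms by (simp add: powr_mult powr_powr)
  finally show ?thesis .
qed

section \<open>Concave index functions\<close>

text \<open>As a function of \<open>x = \<Phi> \<delta>\<close> this is an infimum of increasing
  affine functions, hence concave, and nonnegative slopes preserve concavity under composition with
  \<open>\<Phi>\<close>. The lower bound \<open>b0\<close> on the slopes gives positivity and strict
  monotonicity; arbitrarily small intercepts \<open>a i\<close> give the limit 0.\<close>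

lemma concave_index_function_INF:
  fixes a b :: "'i \<Rightarrow> real"
  assumes \<Phi>: "concave_index_function \<Phi>"
    and a: "\<And>i. i \<in> I \<Longrightarrow> 0 \<le> a i" "\<And>e. 0 < e \<Longrightarrow> \<exists>i\<in>I. a i < e"
    and b: "0 < b0" "\<And>i. i \<in> I \<Longrightarrow> b0 \<le> b i"
  shows "concave_index_function (\<lambda>\<delta>. INF i\<in>I. a i + b i * \<Phi> \<delta>)"
proof -
  let ?G = "\<lambda>x. INF i\<in>I. a i + b i * x"
  have I: "I \<noteq> {}" using a(2)[of 1] by auto
  have bdd: "bdd_below ((\<lambda>i. a i + b i * x) ` I)" if "0 \<le> x" for x
  proof (rule bdd_belowI2)
    fix i
    assume "i \<in> I"
    with a(1)[of i] b that show "0 \<le> a i + b i * x"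
      by (intro add_nonneg_nonneg mult_nonneg_nonneg) (auto intro: order_trans[of 0 b0])
  qed
  have lower: "?G x \<le> a i + b i * x" if "0 \<le> x" "i \<in> I" for x i
    using bdd[OF that(1)] that(2) by (rule cINF_lower)
  \<comment> \<open>Every affine function gains at least \<open>b0 * (y - x)\<close> between
    \<open>x\<close> and \<open>y\<close>, so the infimum does too.\<close>
  have gap: "?G x + b0 * (y - x) \<le> ?G y" if "0 \<le> x" "x \<le> y" for x y
  proof (rule cINF_greatest[OF I])
    fix i
    assume i: "i \<in> I"
    have "b0 * (y - x) \<le> b i * (y - x)"
      using b(2)[OF i] that by (intro mult_right_mono) auto
    then show "?G x + b0 * (y - x) \<le> a i + b i * y"
      using lower[OF that(1) i] by (simp add: algebra_simps)
  qed
  have nonneg: "0 \<le> ?G x" if "0 \<le> x" for x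
    using b a(1) that by (intro cINF_greatest[OF I] add_nonneg_nonneg mult_nonneg_nonneg)
      (auto intro: order_trans[of 0 b0])
  have pos: "0 < ?G x" if "0 < x" for x
  proof -
    have "0 < b0 * x" using b that by simp
    with gap[of 0 x] nonneg[of 0] that show ?thesis by simp
  qed
  have \<Phi>_pos: "0 < \<Phi> \<delta>" if "0 < \<delta>" for \<delta>
    using \<Phi> that unfolding concave_index_function_def index_function_def by blast
  have conc: "concave_on {0<..} (\<lambda>\<delta>. ?G (\<Phi> \<delta>))"
    unfolding concave_on_iff
  proof (intro conjI ballI allI impI)
    fix x y u v :: real
    assume xy: "x \<in> {0<..}" "y \<in> {0<..}" and uv: "0 \<le> u" "0 \<le> v" "u + v = 1"
    have \<Phi>_conc: "u * \<Phi> x + v * \<Phi> y \<le> \<Phi> (u *\<^sub>R x + v *\<^sub>R y)"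
      using \<Phi> xy uv unfolding concave_index_function_def concave_on_iff by blast
    show "u * ?G (\<Phi> x) + v * ?G (\<Phi> y) \<le> ?G (\<Phi> (u *\<^sub>R x + v *\<^sub>R y))"
    proof (rule cINF_greatest[OF I])
      fix i
      assume i: "i \<in> I"
      have "u * ?G (\<Phi> x) + v * ?G (\<Phi> y) \<le> u * (a i + b i * \<Phi> x) + v * (a i + b i * \<Phi> y)"
        using xy uv by (intro add_mono mult_left_mono lower i) (auto intro: less_imp_le[OF \<Phi>_pos])
      also have "\<dots> = (u + v) * a i + b i * (u * \<Phi> x + v * \<Phi> y)"
        by (simp add: algebra_simps)
      also have "\<dots> \<le> a i + b i * \<Phi> (u *\<^sub>R x + v *\<^sub>R y)"
        using \<Phi>_conc b(1) b(2)[OF i] uv by (auto intro: mult_left_mono)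
      finally show "u * ?G (\<Phi> x) + v * ?G (\<Phi> y) \<le> a i + b i * \<Phi> (u *\<^sub>R x + v *\<^sub>R y)" .
    qed
  qed simp
  have lim: "((\<lambda>\<delta>. ?G (\<Phi> \<delta>)) \<longlongrightarrow> 0) (at_right 0)"
  proof (rule order_tendstoI)
    fix e :: real
    assume "0 < e"
    then obtain i where i: "i \<in> I" "a i < e" using a(2) by blast
    have "(\<Phi> \<longlongrightarrow> 0) (at_right 0)"
      using \<Phi> unfolding concave_index_function_def index_function_def by blast
    then have "((\<lambda>\<delta>. a i + b i * \<Phi> \<delta>) \<longlongrightarrow> a i + b i * 0) (at_right 0)"
      by (intro tendsto_intros)
    then have "\<forall>\<^sub>F \<delta> in at_right 0. a i + b i * \<Phi> \<delta> < e"
      using i(2) by (intro order_tendstoD(2)) auto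
    with eventually_at_right_less[of 0] show "\<forall>\<^sub>F \<delta> in at_right 0. ?G (\<Phi> \<delta>) < e"
    proof eventually_elim
      case (elim \<delta>)
      show ?case
        using lower[OF less_imp_le[OF \<Phi>_pos[OF elim(1)]] i(1)] elim(2) by (rule le_less_trans)
    qed
  next
    fix e :: real
    assume "e < 0"
    show "\<forall>\<^sub>F \<delta> in at_right 0. e < ?G (\<Phi> \<delta>)"
      using eventually_at_right_less[of 0]
    proof eventually_elim
      case (elim \<delta>)
      then show ?case using \<open>e < 0\<close> pos[OF \<Phi>_pos] by (meson less_trans)
    qed
  qed
  have "strict_mono_on {0<..} (\<lambda>\<delta>. ?G (\<Phi> \<delta>))"
  proof (rule strict_mono_onI)
    fix x y :: real
    assume xy: "x \<in> {0<..}" "y \<in> {0<..}" "x < y"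
    then have lt: "\<Phi> x < \<Phi> y"
      using \<Phi> unfolding concave_index_function_def index_function_def strict_mono_on_def by blast
    then have "0 < b0 * (\<Phi> y - \<Phi> x)" using b by simp
    with gap[of "\<Phi> x" "\<Phi> y"] lt xy \<Phi>_pos[of x] show "?G (\<Phi> x) < ?G (\<Phi> y)" by simp
  qed
  \<comment> \<open>Continuity follows from concavity, a convex function being continuous on an open
    interval.\<close>
  moreover have "continuous_on {0<..} (\<lambda>\<delta>. ?G (\<Phi> \<delta>))"
    using convex_on_continuous[OF open_greaterThan conc[unfolded concave_on_def]]
    by (auto dest: continuous_on_minus)
  ultimately show ?thesis
    using conc lim pos \<Phi>_pos unfolding concave_index_function_def index_function_def by blast
qed

lemma concave_index_function_cmult:
  assumes "concave_index_function \<Phi>" "0 < c"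
  shows "concave_index_function (\<lambda>\<delta>. c * \<Phi> \<delta>)"
proof -
  have "((\<lambda>\<delta>. c * \<Phi> \<delta>) \<longlongrightarrow> c * 0) (at_right 0)"
    using assms unfolding concave_index_function_def index_function_def by (intro tendsto_mult_left) auto
  then show ?thesis
    using assms unfolding concave_index_function_def index_function_def strict_mono_on_def
    by (auto intro!: continuous_intros concave_on_cmul)
qed

text \<open>Serves the points \<open>x\<close> with the same image under \<open>T\<close> as
  \<open>xdag\<close>: there \<open>\<Psi>0\<close> contributes 0 and the infimum reduces to that of
  the intercepts, in agreement with the extension by 0.\<close>

lemma INF_eq_0:
  fixes a :: "'i \<Rightarrow> real"
  assumes "\<And>i. i \<in> I \<Longrightarrow> 0 \<le> a i" "\<And>e. 0 < e \<Longrightarrow> \<exists>i\<in>I. a i < e"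
  shows "(INF i\<in>I. a i) = 0"
proof (rule cInf_eq_non_empty)
  show "a ` I \<noteq> {}" using assms(2)[of 1] by auto
  show "y \<le> 0" if "\<And>x. x \<in> a ` I \<Longrightarrow> y \<le> x" for y
    using assms(2)[of y] that by (meson imageI leD not_le)
qed (use assms(1) in auto)

text \<open>The infimum is estimated by a single value. With \<open>r = 1 + (q - 1) * s\<close> and
  \<open>x = 2 powr (- (l * r))\<close>, both \<open>2 powr (- (l * q * s))\<close> and
  \<open>2 powr (l * (1 - s)) * x\<close> equal \<open>x powr (q * s / r)\<close>; the upper bound
  on \<open>x\<close> says that this \<open>l\<close> is at least 1.\<close>

lemma INF_rate_le:
  fixes s q A B x :: real
  assumes s: "0 < s" "s \<le> 1" and q: "1 < q" and A: "0 \<le> A" and B: "0 \<le> B"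
    and x: "0 < x" "x \<le> 2 powr (- (1 + (q - 1) * s))"
  shows "(INF l\<in>{1::real..}. 1 / 2 powr (l * q * s) * A + 2 powr ((l + 1) * (1 - s)) * B * x)
    \<le> (A + 2 powr (1 - s) * B) * x powr (q * s / (1 + (q - 1) * s))"
proof -
  let ?f = "\<lambda>l. 1 / 2 powr (l * q * s) * A + 2 powr ((l + 1) * (1 - s)) * B * x"
  define r where "r = 1 + (q - 1) * s"
  have r: "0 < r" using s q unfolding r_def by (simp add: add_pos_nonneg)
  \<comment> \<open>this value of \<open>l\<close> balances the two summands\<close>
  define l where "l = - log 2 x / r"
  have x_eq: "x = 2 powr (- (l * r))"
    using x(1) r by (simp add: l_def)
  have "- (l * r) \<le> - r"
    using x(2) unfolding x_eq r_def[symmetric] by simp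
  then have l: "1 \<le> l" using r by (simp add: mult_le_cancel_right1)
  have xp: "x powr (q * s / r) = 2 powr (- (l * q * s))"
    unfolding x_eq using r by (simp add: powr_powr mult.assoc)
  have "(INF l\<in>{1::real..}. ?f l) \<le> ?f l"
    using l A B x by (intro cINF_lower bdd_belowI2[of _ 0]) auto
  also have "1 / 2 powr (l * q * s) * A = A * x powr (q * s / r)"
    unfolding xp by (simp add: powr_minus divide_simps)
  also have "2 powr ((l + 1) * (1 - s)) * B * x = 2 powr (1 - s) * B * x powr (q * s / r)"
  proof -
    have "2 powr ((l + 1) * (1 - s)) * x = 2 powr (1 - s) * 2 powr (- (l * q * s))"
      unfolding x_eq r_def powr_add[symmetric] by (simp add: algebra_simps)
    then show ?thesis unfolding xp by (simp add: mult_ac)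
  qed
  finally show ?thesis unfolding r_def by (simp add: algebra_simps)
qed

section \<open>Littlewood-Paley decompositions\<close>

text \<open>The constants that the decomposition only asserts to exist become parameters, so that
  later bounds can name them. At index 0 all weights are 1, so \<open>lower\<close> can be stated
  through \<open>F_enorm\<close>.\<close>

locale Littlewood_Paley =
  fixes q :: real and M :: "'a measure"
    and P :: "nat \<Rightarrow> ('a \<Rightarrow> complex) \<Rightarrow> 'a \<Rightarrow> complex" and K c :: real
  assumes q: "1 < q"
    and bounded_operator: "\<And>j. Lp_bounded_operator q M (P j)"
    and K: "0 \<le> K" "\<And>j z. z \<in> Lp q M \<Longrightarrow> Lp_norm q M (P j z) \<le> K * Lp_norm q M z"
    and commute: "\<And>j k z. z \<in> Lp q M \<Longrightarrow> AE \<omega> in M. P j (P k z) \<omega> = P k (P j z) \<omega>"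
    and decomp: "\<And>z. z \<in> Lp q M \<Longrightarrow> Lp_tendsto q M (\<lambda>n \<omega>. \<Sum>j<n. P j z \<omega>) z"
    and orth: "\<And>j k z. z \<in> Lp q M \<Longrightarrow> \<bar>int j - int k\<bar> \<ge> 2 \<Longrightarrow> AE \<omega> in M. P j (P k z) \<omega> = 0"
    and c: "1 \<le> c"
    and lower: "\<And>z. z \<in> Lp q M \<Longrightarrow> ennreal (1 / c * Lp_norm q M z) \<le> F_enorm q M P 0 z"

lemma LP_decomposition_Littlewood_Paley:
  assumes "LP_decomposition q M P" "1 < q"
  obtains K c where "Littlewood_Paley q M P K c"
proof -
  note LP = assms(1)[unfolded LP_decomposition_def]
  from LP obtain K where K: "\<forall>j. \<forall>z\<in>Lp q M. Lp_norm q M (P j z) \<le> K * Lp_norm q M z"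
    by (elim conjE exE) (rule that)
  from LP obtain c where c: "1 \<le> c" "\<forall>z\<in>Lp q M. ennreal (1 / c * Lp_norm q M z)
      \<le> eLp_norm q M (\<lambda>\<omega>. ennpowr (\<Sum>j. ennreal ((cmod (P j z \<omega>))\<^sup>2)) (1 / 2))"
    by (elim conjE exE) (rule that, assumption, blast)
  \<comment> \<open>The bound \<open>K\<close> from the definition carries no sign; its positive
    part keeps multiplication by it monotone.\<close>
  have "Littlewood_Paley q M P (max K 0) c"
  proof
    fix j and z :: "'a \<Rightarrow> complex"
    assume z: "z \<in> Lp q M"
    have "K * Lp_norm q M z \<le> max K 0 * Lp_norm q M z"
      by (rule mult_right_mono) auto
    with K[rule_format, OF z] show "Lp_norm q M (P j z) \<le> max K 0 * Lp_norm q M z"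
      by (rule order_trans)
  next
    fix z :: "'a \<Rightarrow> complex"
    assume "z \<in> Lp q M"
    then show "ennreal (1 / c * Lp_norm q M z) \<le> F_enorm q M P 0 z"
      unfolding F_enorm_def using c(2) by simp
  qed (use LP assms(2) c(1) in \<open>(elim conjE; blast) | simp\<close>)+
  then show ?thesis by (rule that)
qed

context Littlewood_Paley
begin

section \<open>The operators on partial sums\<close>

lemma P_Lp: "z \<in> Lp q M \<Longrightarrow> P j z \<in> Lp q M"
  using bounded_operator unfolding Lp_bounded_operator_def by blast

lemma P_linear:
  "f \<in> Lp q M \<Longrightarrow> g \<in> Lp q M \<Longrightarrow>
    AE \<omega> in M. P j (\<lambda>\<omega>'. a * f \<omega>' + b * g \<omega>') \<omega> = a * P j f \<omega> + b * P j g \<omega>"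
  using bounded_operator unfolding Lp_bounded_operator_def by blast

lemma P_diff:
  "f \<in> Lp q M \<Longrightarrow> g \<in> Lp q M \<Longrightarrow> AE \<omega> in M. P j (\<lambda>\<omega>'. f \<omega>' - g \<omega>') \<omega> = P j f \<omega> - P j g \<omega>"
  using P_linear[of f g j 1 "-1"] by simp

lemma P_cmult:
  "f \<in> Lp q M \<Longrightarrow> AE \<omega> in M. P j (\<lambda>\<omega>'. a * f \<omega>') \<omega> = a * P j f \<omega>"
  using P_linear[of f f j a 0] by simp

lemma P_sum:
  assumes "\<And>k. k < n \<Longrightarrow> g k \<in> Lp q M"
  shows "AE \<omega> in M. P j (\<lambda>\<omega>'. \<Sum>k<n. g k \<omega>') \<omega> = (\<Sum>k<(n::nat). P j (g k) \<omega>)"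
  using assms
proof (induction n)
  case 0
  then show ?case using P_cmult[OF Lp_zero, of j 0] by simp
next
  case (Suc n)
  have "AE \<omega> in M. P j (\<lambda>\<omega>'. (\<Sum>k<n. g k \<omega>') + g n \<omega>') \<omega>
      = P j (\<lambda>\<omega>'. \<Sum>k<n. g k \<omega>') \<omega> + P j (g n) \<omega>"
    using P_linear[OF Lp_sum[of "{..<n}" g] Suc.prems, of n j 1 1] Suc.prems q by simp
  moreover have "AE \<omega> in M. P j (\<lambda>\<omega>'. \<Sum>k<n. g k \<omega>') \<omega> = (\<Sum>k<n. P j (g k) \<omega>)"
    using Suc by simp
  ultimately show ?case by eventually_elim simp
qed

text \<open>The sum runs over \<open>k < n\<close>, so the low-frequency part with cut-off
  \<open>m\<close> is \<open>partial_sum (Suc m)\<close>.\<close>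

definition partial_sum :: "nat \<Rightarrow> ('a \<Rightarrow> complex) \<Rightarrow> 'a \<Rightarrow> complex"
  where "partial_sum n z \<omega> = (\<Sum>k<n. P k z \<omega>)"

lemma partial_sum_Lp: "z \<in> Lp q M \<Longrightarrow> partial_sum n z \<in> Lp q M"
  unfolding partial_sum_def using q by (auto intro!: Lp_sum P_Lp)

lemma P_partial_sum:
  "z \<in> Lp q M \<Longrightarrow> AE \<omega> in M. P j (partial_sum n z) \<omega> = (\<Sum>k<n. P j (P k z) \<omega>)"
  using P_sum[of n "\<lambda>k. P k z" j] P_Lp unfolding partial_sum_def by blast

text \<open>Countably many null sets are merged into one, so that sums over \<open>k\<close> can be
  simplified pointwise.\<close>

lemma orth_all:
  assumes "z \<in> Lp q M"
  shows "AE \<omega> in M. \<forall>k. \<bar>int j - int k\<bar> \<ge> 2 \<longrightarrow> P j (P k z) \<omega> = 0"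
  unfolding AE_all_countable
proof
  fix k
  show "AE \<omega> in M. \<bar>int j - int k\<bar> \<ge> 2 \<longrightarrow> P j (P k z) \<omega> = 0"
  proof (cases "\<bar>int j - int k\<bar> \<ge> 2")
    case True
    then show ?thesis using orth[OF assms True] by eventually_elim simp
  next
    case False
    then show ?thesis by simp
  qed
qed

lemma P_partial_sum_high:
  assumes "z \<in> Lp q M" "n < j"
  shows "AE \<omega> in M. P j (partial_sum n z) \<omega> = 0"
  using P_partial_sum[OF assms(1), of j n] orth_all[OF assms(1), of j]
proof eventually_elim
  case (elim \<omega>)
  \<comment> \<open>From \<open>k < n < j\<close> the distance of \<open>j\<close> and
    \<open>k\<close> is at least 2.\<close>
  have "P j (P k z) \<omega> = 0" if "k < n" for k
    using that assms(2) by (intro elim(2)[rule_format]) linarith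
  then show ?case using elim(1) by (simp add: sum.neutral)
qed

text \<open>All \<open>P j (P k z)\<close> with \<open>k \<ge> n\<close> vanish, so the difference
  of the two sides does not change when \<open>n\<close> is raised to any \<open>m \<ge> n\<close>.
  For large \<open>m\<close> it is small in norm, by the boundedness of \<open>P j\<close> and the
  convergence of the partial sums to \<open>z\<close>.\<close>

lemma P_partial_sum_low:
  assumes z: "z \<in> Lp q M" and n: "j + 2 \<le> n"
  shows "AE \<omega> in M. P j (partial_sum n z) \<omega> = P j z \<omega>"
proof -
  let ?d = "\<lambda>\<omega>. P j z \<omega> - P j (partial_sum n z) \<omega>"
  have d: "?d \<in> Lp q M"
    using z q by (intro Lp_diff P_Lp partial_sum_Lp) auto
  have "Lp_norm q M ?d \<le> K * Lp_norm q M (\<lambda>\<omega>. partial_sum m z \<omega> - z \<omega>)" if "m \<ge> n" for m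
  proof -
    have zm: "(\<lambda>\<omega>. z \<omega> - partial_sum m z \<omega>) \<in> Lp q M"
      using z q by (intro Lp_diff partial_sum_Lp) auto
    have "AE \<omega> in M. ?d \<omega> = P j (\<lambda>\<omega>. z \<omega> - partial_sum m z \<omega>) \<omega>"
      using P_partial_sum[OF z, of j n] P_partial_sum[OF z, of j m] orth_all[OF z, of j]
        P_diff[OF z partial_sum_Lp[OF z], of j m]
    proof eventually_elim
      case (elim \<omega>)
      have "(\<Sum>k<n. P j (P k z) \<omega>) = (\<Sum>k<m. P j (P k z) \<omega>)"
      proof (rule sum.mono_neutral_left)
        show "\<forall>k\<in>{..<m} - {..<n}. P j (P k z) \<omega> = 0"
        proof
          fix k
          assume "k \<in> {..<m} - {..<n}"
          then show "P j (P k z) \<omega> = 0"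
            using n by (intro elim(3)[rule_format]) simp
        qed
      qed (use that in auto)
      with elim show ?case by simp
    qed
    then have "Lp_norm q M ?d = Lp_norm q M (P j (\<lambda>\<omega>. z \<omega> - partial_sum m z \<omega>))"
      using d P_Lp[OF zm] by (intro Lp_norm_cong_AE) auto
    also have "\<dots> \<le> K * Lp_norm q M (\<lambda>\<omega>. z \<omega> - partial_sum m z \<omega>)"
      by (rule K(2)[OF zm])
    finally show ?thesis by (simp add: Lp_norm_def norm_minus_commute)
  qed
  moreover have "(\<lambda>m. K * Lp_norm q M (\<lambda>\<omega>. partial_sum m z \<omega> - z \<omega>)) \<longlonglongrightarrow> K * 0"
    using decomp[OF z] unfolding Lp_tendsto_def partial_sum_def by (intro tendsto_mult_left)
  ultimately have "Lp_norm q M ?d \<le> K * 0"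
    by (intro LIMSEQ_le_const) auto
  then have "AE \<omega> in M. ?d \<omega> = 0"
    using d Lp_norm_nonneg[of q M ?d] by (intro Lp_norm_eq_0_imp_AE) auto
  then show ?thesis by eventually_elim simp
qed

text \<open>At most three neighbours \<open>k\<close> of \<open>j\<close> contribute. Commuting the
  operators puts \<open>P j\<close> innermost, so that the bound is by \<open>P j z\<close> and not
  by \<open>z\<close>. The number 192 is \<open>4 ^ 3 * 3\<close>, from the triangle inequality for
  three terms.\<close>

lemma P_partial_sum_bound:
  assumes z: "z \<in> Lp q M"
  shows "Lp_norm q M (P j (partial_sum n z)) \<le> 192 * K * Lp_norm q M (P j z)"
proof -
  \<comment> \<open>For \<open>j = 0\<close> truncated subtraction turns the interval into
    \<open>{0..1}\<close>, which still contains all neighbours.\<close>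
  let ?I = "{..<n} \<inter> {j - 1..j + 1}"
  have "AE \<omega> in M. \<forall>k. P j (P k z) \<omega> = P k (P j z) \<omega>"
    using commute[OF z] by (subst AE_all_countable) auto
  then have "AE \<omega> in M. P j (partial_sum n z) \<omega> = (\<Sum>k\<in>?I. P k (P j z) \<omega>)"
    using P_partial_sum[OF z, of j n] orth_all[OF z, of j]
  proof eventually_elim
    case (elim \<omega>)
    have "P j (P k z) \<omega> = 0" if "k \<notin> {j - 1..j + 1}" for k
      using that by (intro elim(3)[rule_format]) (simp, linarith)
    then have "(\<Sum>k\<in>?I. P j (P k z) \<omega>) = (\<Sum>k<n. P j (P k z) \<omega>)"
      by (intro sum.mono_neutral_left) auto
    with elim show ?case by simp
  qed
  then have "Lp_norm q M (P j (partial_sum n z)) = Lp_norm q M (\<lambda>\<omega>. \<Sum>k\<in>?I. P k (P j z) \<omega>)"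
    using z q by (intro Lp_norm_cong_AE Lp_measurable[where q = q] P_Lp partial_sum_Lp Lp_sum) auto
  also have "\<dots> \<le> 4 ^ card ?I * (\<Sum>k\<in>?I. Lp_norm q M (P k (P j z)))"
    using z q by (intro Lp_norm_sum_le P_Lp) auto
  also have "\<dots> \<le> 4 ^ card ?I * (card ?I * (K * Lp_norm q M (P j z)))"
    using z by (intro mult_left_mono sum_bounded_above K P_Lp) auto
  also have "\<dots> \<le> 4 ^ 3 * (3 * (K * Lp_norm q M (P j z)))"
  proof -
    have "card ?I \<le> card {j - 1..j + 1}" by (intro card_mono) auto
    then have "card ?I \<le> 3" by simp
    then show ?thesis
      using K(1) by (intro mult_mono power_increasing) auto
  qed
  finally show ?thesis by simp
qed

section \<open>Square functions and the norms of the scale\<close>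

definition square_function :: "real \<Rightarrow> ('a \<Rightarrow> complex) \<Rightarrow> 'a \<Rightarrow> ennreal"
  where "square_function t z \<omega> = ennpowr (\<Sum>j. ennreal (2 powr (2 * real j * t) * (cmod (P j z \<omega>))\<^sup>2)) (1/2)"

lemma F_enorm_eq: "F_enorm q M P t z = eLp_norm q M (square_function t z)"
  unfolding F_enorm_def square_function_def ..

lemma weight_square: "2 powr (2 * real j * t) * x\<^sup>2 = (2 powr (real j * t) * x)\<^sup>2"
proof -
  have "2 powr (2 * real j * t) = (2 powr (real j * t))\<^sup>2"
    by (simp add: powr_power mult.assoc)
  then show ?thesis by (simp add: power_mult_distrib)
qed

lemma square_function_measurable:
  assumes "z \<in> Lp q M"
  shows "square_function t z \<in> borel_measurable M"
proof -
  have "(\<lambda>\<omega>. ennreal (2 powr (2 * real j * t) * (cmod (P j z \<omega>))\<^sup>2)) \<in> borel_measurable M" for j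
    using P_Lp[OF assms, THEN Lp_measurable, of j] by measurable
  then have "(\<lambda>\<omega>. \<Sum>j. ennreal (2 powr (2 * real j * t) * (cmod (P j z \<omega>))\<^sup>2)) \<in> borel_measurable M"
    by (rule borel_measurable_suminf_order)
  then show ?thesis
    unfolding square_function_def[abs_def] by (rule ennpowr_measurable)
qed

lemma P_le_square_function:
  "ennreal (2 powr (real j * t) * cmod (P j z \<omega>)) \<le> square_function t z \<omega>"
proof -
  let ?u = "\<lambda>j. ennreal (2 powr (2 * real j * t) * (cmod (P j z \<omega>))\<^sup>2)"
  have "ennreal (2 powr (real j * t) * cmod (P j z \<omega>)) = ennpowr (?u j) (1/2)"
    unfolding weight_square by (rule ennpowr_half_square[symmetric]) simp
  also have "(\<Sum>i\<in>{j}. ?u i) \<le> (\<Sum>j. ?u j)"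
    by (rule sum_le_suminf) (rule summableI, simp_all)
  then have "ennpowr (?u j) (1/2) \<le> square_function t z \<omega>"
    unfolding square_function_def by (intro ennpowr_mono) simp_all
  finally show ?thesis .
qed

lemma eLp_norm_weighted:
  assumes "z \<in> Lp q M" "0 \<le> a"
  shows "eLp_norm q M (\<lambda>\<omega>. ennreal (a * cmod (z \<omega>))) = ennreal (a * Lp_norm q M z)"
proof -
  have [measurable]: "z \<in> borel_measurable M" using assms(1) by (rule Lp_measurable)
  have "eLp_norm q M (\<lambda>\<omega>. ennreal (a * cmod (z \<omega>))) = eLp_norm q M (\<lambda>\<omega>. ennreal a * ennreal (cmod (z \<omega>)))"
    using assms(2) by (simp only: ennreal_mult norm_ge_zero)
  also have "\<dots> = ennreal a * eLp_norm q M (\<lambda>\<omega>. ennreal (cmod (z \<omega>)))"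
    using q assms(2) by (intro eLp_norm_cmult) auto
  also have "\<dots> = ennreal (a * Lp_norm q M z)"
    using assms(2) by (simp only: eLp_norm_eq_Lp_norm[OF assms(1)] ennreal_mult Lp_norm_nonneg)
  finally show ?thesis .
qed

lemma P_norm_le_F_enorm:
  assumes "z \<in> Lp q M"
  shows "ennreal (2 powr (real j * t) * Lp_norm q M (P j z)) \<le> F_enorm q M P t z"
proof -
  have "eLp_norm q M (\<lambda>\<omega>. ennreal (2 powr (real j * t) * cmod (P j z \<omega>))) \<le> F_enorm q M P t z"
    unfolding F_enorm_eq using q by (intro eLp_norm_mono_AE AE_I2 P_le_square_function) auto
  then show ?thesis using eLp_norm_weighted[OF P_Lp[OF assms]] by simp
qed

lemma square_function_mono:
  assumes "t \<le> t'"
  shows "square_function t z \<omega> \<le> square_function t' z \<omega>"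
  unfolding square_function_def using assms
  by (intro ennpowr_mono suminf_le summableI ennreal_leI mult_right_mono powr_mono mult_left_mono) auto

text \<open>For nonnegative \<open>t\<close> the weights are at least those of index 0, where the
  lower square function estimate applies. This is the embedding into the Lebesgue space, with
  constant \<open>c\<close>.\<close>

lemma Lp_norm_le_F_enorm:
  assumes "z \<in> Lp q M" "0 \<le> t"
  shows "ennreal (Lp_norm q M z) \<le> ennreal c * F_enorm q M P t z"
proof -
  have "ennreal (1 / c * Lp_norm q M z) \<le> F_enorm q M P t z"
  proof (rule order_trans[OF lower[OF assms(1)]])
    show "F_enorm q M P 0 z \<le> F_enorm q M P t z"
      unfolding F_enorm_eq using q assms(2)
      by (intro eLp_norm_mono_AE AE_I2 square_function_mono) auto
  qed
  then have "ennreal c * ennreal (1 / c * Lp_norm q M z) \<le> ennreal c * F_enorm q M P t z"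
    by (rule mult_left_mono) simp
  then show ?thesis using c by (simp add: ennreal_mult[symmetric])
qed

lemma F_enorm_cmult:
  assumes "z \<in> Lp q M"
  shows "F_enorm q M P t (\<lambda>\<omega>. a * z \<omega>) = ennreal (cmod a) * F_enorm q M P t z"
proof -
  have "AE \<omega> in M. \<forall>j. P j (\<lambda>\<omega>. a * z \<omega>) \<omega> = a * P j z \<omega>"
    using P_cmult[OF assms] by (subst AE_all_countable) auto
  then have "AE \<omega> in M. square_function t (\<lambda>\<omega>. a * z \<omega>) \<omega> = ennreal (cmod a) * square_function t z \<omega>"
  proof eventually_elim
    case (elim \<omega>)
    have "square_function t (\<lambda>\<omega>. a * z \<omega>) \<omega>
       = ennpowr (\<Sum>j. ennreal ((cmod a)\<^sup>2) * ennreal (2 powr (2 * real j * t) * (cmod (P j z \<omega>))\<^sup>2)) (1/2)"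
      unfolding square_function_def using elim
      by (simp add: ennreal_mult[symmetric] norm_mult power_mult_distrib mult_ac)
    also have "\<dots> = ennreal (cmod a) * square_function t z \<omega>"
      unfolding square_function_def
      by (simp add: ennpowr_mult powr_half_sqrt)
    finally show ?case .
  qed
  then have "F_enorm q M P t (\<lambda>\<omega>. a * z \<omega>) = eLp_norm q M (\<lambda>\<omega>. ennreal (cmod a) * square_function t z \<omega>)"
    unfolding F_enorm_eq using q by (intro antisym eLp_norm_mono_AE) (auto elim: eventually_mono)
  also have "\<dots> = ennreal (cmod a) * F_enorm q M P t z"
    unfolding F_enorm_eq using q by (intro eLp_norm_cmult square_function_measurable assms) auto
  finally show ?thesis .
qed

text \<open>Common core of the estimates for low and high frequencies. Off \<open>m\<close> and
  \<open>Suc m\<close> the components compare pointwise, hence so do the square functions. The two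
  exceptional components compare only in norm; they are split off by the subadditivity of the square
  root, and a single component of \<open>f\<close> is dominated by the full norm of
  \<open>f\<close>.\<close>

lemma F_enorm_compare:
  assumes z: "z \<in> Lp q M" and f: "f \<in> Lp q M" and A: "0 \<le> A" and B: "0 \<le> B"
    and off: "\<And>j. j \<noteq> m \<Longrightarrow> j \<noteq> Suc m \<Longrightarrow>
      AE \<omega> in M. 2 powr (real j * t) * cmod (P j z \<omega>) \<le> A * (2 powr (real j * t') * cmod (P j f \<omega>))"
    and diag: "\<And>j. j = m \<or> j = Suc m \<Longrightarrow>
      2 powr (real j * t) * Lp_norm q M (P j z) \<le> B * A * (2 powr (real j * t') * Lp_norm q M (P j f))"
  shows "F_enorm q M P t z \<le> ennreal (4 * (1 + 8 * B) * A) * F_enorm q M P t' f"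
proof -
  have [measurable]: "P j z \<in> borel_measurable M" "square_function t' f \<in> borel_measurable M" for j
    by (intro Lp_measurable[OF P_Lp[OF z]] square_function_measurable[OF f])+
  let ?e = "\<lambda>j \<omega>. ennreal (2 powr (real j * t) * cmod (P j z \<omega>))"
  let ?u = "\<lambda>j \<omega>. ennreal (2 powr (2 * real j * t) * (cmod (P j z \<omega>))\<^sup>2)"
  let ?v = "\<lambda>j \<omega>. ennreal (2 powr (2 * real j * t') * (cmod (P j f \<omega>))\<^sup>2)"
  let ?F = "F_enorm q M P t' f"
  have "AE \<omega> in M. \<forall>j. j \<noteq> m \<longrightarrow> j \<noteq> Suc m \<longrightarrow>
      2 powr (real j * t) * cmod (P j z \<omega>) \<le> A * (2 powr (real j * t') * cmod (P j f \<omega>))"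
    using off by (subst AE_all_countable) auto
  then have "AE \<omega> in M. square_function t z \<omega> \<le> ennreal A * square_function t' f \<omega> + (?e m \<omega> + ?e (Suc m) \<omega>)"
  proof eventually_elim
    case (elim \<omega>)
    \<comment> \<open>The exceptional terms are written as series with one nonzero entry, so that
      the comparison can be made term by term.\<close>
    let ?w = "\<lambda>i j. if j = i then ?u i \<omega> else 0"
    have w: "(\<Sum>j. ?w i j) = ?u i \<omega>" for i
      using suminf_finite[of "{i}" "?w i"] by auto
    have uv: "?u j \<omega> \<le> ennreal (A\<^sup>2) * ?v j \<omega> + (?w m j + ?w (Suc m) j)" for j
    proof (cases "j = m \<or> j = Suc m")
      case True
      then show ?thesis by (auto intro: add_increasing)
    next
      case False
      then have "2 powr (real j * t) * cmod (P j z \<omega>) \<le> A * (2 powr (real j * t') * cmod (P j f \<omega>))"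
        using elim by auto
      then have "(2 powr (real j * t) * cmod (P j z \<omega>))\<^sup>2 \<le> (A * (2 powr (real j * t') * cmod (P j f \<omega>)))\<^sup>2"
        by (intro power_mono) auto
      then show ?thesis
        unfolding weight_square using False by (simp add: ennreal_mult[symmetric] power_mult_distrib ennreal_leI)
    qed
    have "(\<Sum>j. ?u j \<omega>) \<le> (\<Sum>j. ennreal (A\<^sup>2) * ?v j \<omega> + (?w m j + ?w (Suc m) j))"
      by (intro suminf_le summableI uv)
    also have "\<dots> = (\<Sum>j. ennreal (A\<^sup>2) * ?v j \<omega>) + ((\<Sum>j. ?w m j) + (\<Sum>j. ?w (Suc m) j))"
      by (simp only: suminf_add[OF summableI summableI])
    also have "\<dots> = ennreal (A\<^sup>2) * (\<Sum>j. ?v j \<omega>) + (?u m \<omega> + ?u (Suc m) \<omega>)"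
      unfolding w by simp
    finally have "square_function t z \<omega> \<le> ennpowr (ennreal (A\<^sup>2) * (\<Sum>j. ?v j \<omega>) + (?u m \<omega> + ?u (Suc m) \<omega>)) (1/2)"
      unfolding square_function_def by (rule ennpowr_mono) simp
    also have "\<dots> \<le> ennpowr (ennreal (A\<^sup>2) * (\<Sum>j. ?v j \<omega>)) (1/2) + (ennpowr (?u m \<omega>) (1/2) + ennpowr (?u (Suc m) \<omega>) (1/2))"
      by (meson add_left_mono ennpowr_half_add_le order_trans)
    also have "\<dots> = ennreal A * square_function t' f \<omega> + (?e m \<omega> + ?e (Suc m) \<omega>)"
      unfolding weight_square[of _ t] square_function_def
      using A by (simp add: ennpowr_half_square ennpowr_mult powr_half_sqrt)
    finally show ?case .
  qed
  then have "F_enorm q M P t z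
      \<le> eLp_norm q M (\<lambda>\<omega>. ennreal A * square_function t' f \<omega> + (?e m \<omega> + ?e (Suc m) \<omega>))"
    unfolding F_enorm_eq using q by (intro eLp_norm_mono_AE) auto
  also have "\<dots> \<le> 4 * (eLp_norm q M (\<lambda>\<omega>. ennreal A * square_function t' f \<omega>) + eLp_norm q M (\<lambda>\<omega>. ?e m \<omega> + ?e (Suc m) \<omega>))"
    using q by (intro eLp_norm_add_le) auto
  also have "\<dots> \<le> 4 * (ennreal A * ?F + 4 * (eLp_norm q M (?e m) + eLp_norm q M (?e (Suc m))))"
    using q A by (intro mult_left_mono add_mono eLp_norm_add_le) (auto simp: eLp_norm_cmult F_enorm_eq)
  also have "\<dots> \<le> 4 * (ennreal A * ?F + 4 * (ennreal (B * A) * ?F + ennreal (B * A) * ?F))"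
  proof -
    have "eLp_norm q M (?e j) \<le> ennreal (B * A) * ?F" if "j = m \<or> j = Suc m" for j
    proof -
      have "eLp_norm q M (?e j) \<le> ennreal (B * A * (2 powr (real j * t') * Lp_norm q M (P j f)))"
        using diag[OF that] eLp_norm_weighted[OF P_Lp[OF z]] by (simp add: ennreal_leI)
      also have "\<dots> = ennreal (B * A) * ennreal (2 powr (real j * t') * Lp_norm q M (P j f))"
        using A B by (simp add: ennreal_mult)
      also have "\<dots> \<le> ennreal (B * A) * ?F"
        by (intro mult_left_mono P_norm_le_F_enorm f) simp
      finally show ?thesis .
    qed
    from this[of m] this[of "Suc m"] show ?thesis
      by (intro mult_left_mono add_mono order_refl) auto
  qed
  also have "\<dots> = (4 * (ennreal A + 4 * (ennreal (B * A) + ennreal (B * A)))) * ?F"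
    by (simp add: algebra_simps)
  also have "4 * (ennreal A + 4 * (ennreal (B * A) + ennreal (B * A))) = ennreal (4 * (A + 4 * (B * A + B * A)))"
  proof -
    have "4 * (ennreal A + 4 * (ennreal d + ennreal d)) = ennreal (4 * (A + 4 * (d + d)))" if "0 \<le> d" for d
    proof -
      have "16 * x + 16 * x = 32 * x" for x :: ennreal
        by (simp add: distrib_right[symmetric])
      then show ?thesis using A that by (simp add: ennreal_mult)
    qed
    then show ?thesis using A B by simp
  qed
  also have "4 * (A + 4 * (B * A + B * A)) = 4 * (1 + 8 * B) * A"
    by (simp add: algebra_simps)
  finally show ?thesis .
qed

section \<open>Real-valued norms and the pairing with the dual norm\<close>

lemma ennreal_F_norm: "z \<in> F_space q M P t \<Longrightarrow> ennreal (F_norm q M P t z) = F_enorm q M P t z"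
  unfolding F_space_def F_norm_def by (intro ennreal_enn2real) (simp add: top.not_eq_extremum)

lemma F_norm_nonneg [simp]: "0 \<le> F_norm q M P t z"
  unfolding F_norm_def by simp

lemma F_space_Lp: "z \<in> F_space q M P t \<Longrightarrow> z \<in> Lp q M"
  unfolding F_space_def by simp

lemma F_spaceI:
  assumes "z \<in> Lp q M" "F_enorm q M P t z \<le> ennreal a" "0 \<le> a"
  shows "z \<in> F_space q M P t" "F_norm q M P t z \<le> a"
proof -
  show "z \<in> F_space q M P t"
    using assms(1,2) unfolding F_space_def by (simp add: le_less_trans)
  from ennreal_F_norm[OF this] assms(2,3) show "F_norm q M P t z \<le> a"
    by (metis ennreal_le_iff)
qed

lemma Lp_norm_le_F_norm:
  assumes "z \<in> F_space q M P t" "0 \<le> t"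
  shows "Lp_norm q M z \<le> c * F_norm q M P t z"
proof -
  have "ennreal (Lp_norm q M z) \<le> ennreal c * ennreal (F_norm q M P t z)"
    using Lp_norm_le_F_enorm[OF F_space_Lp[OF assms(1)] assms(2)] ennreal_F_norm[OF assms(1)] by simp
  also have "\<dots> = ennreal (c * F_norm q M P t z)"
    using c by (simp add: ennreal_mult)
  finally show ?thesis using c by (simp add: ennreal_le_iff)
qed

lemma F_norm_pos:
  assumes "z \<in> F_space q M P t" "0 \<le> t" "\<not> (AE \<omega> in M. z \<omega> = 0)"
  shows "0 < F_norm q M P t z"
proof (rule ccontr)
  assume "\<not> 0 < F_norm q M P t z"
  then have "F_norm q M P t z = 0"
    using F_norm_nonneg[of t z] by linarith
  then have "Lp_norm q M z = 0"
    using Lp_norm_le_F_norm[OF assms(1,2)] Lp_norm_nonneg[of q M z] by simp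
  then show False
    using Lp_norm_eq_0_imp_AE[OF F_space_Lp[OF assms(1)]] assms(3) by blast
qed

context
  fixes p t :: real and h :: "'a \<Rightarrow> complex"
  assumes p: "1 < p" "1/p + 1/q = 1" and h: "h \<in> Lp p M" and t: "0 \<le> t"
begin

lemma pairing_le_F_norm:
  assumes "g \<in> F_space q M P t"
  shows "cmod (pairing M h g) \<le> Lp_norm p M h * (c * F_norm q M P t g)"
  using Holder_inequality(2)[OF p(1) q p(2) h F_space_Lp[OF assms]]
    mult_left_mono[OF Lp_norm_le_F_norm[OF assms t] Lp_norm_nonneg[of p M h]] by linarith

text \<open>A real supremum bounds its members only if the set is bounded above; Hoelder's
  inequality and the embedding provide this.\<close>

lemma pairing_le_F_dual_norm_unit:
  assumes "g \<in> F_space q M P t" "F_norm q M P t g \<le> 1"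
  shows "cmod (pairing M h g) \<le> F_dual_norm q M P t h"
  unfolding F_dual_norm_def
proof (rule cSUP_upper)
  show "bdd_above ((\<lambda>g. cmod (pairing M h g)) ` {g \<in> F_space q M P t. F_norm q M P t g \<le> 1})"
  proof (rule bdd_aboveI2)
    fix g
    assume "g \<in> {g \<in> F_space q M P t. F_norm q M P t g \<le> 1}"
    then have g: "g \<in> F_space q M P t" "F_norm q M P t g \<le> 1" by auto
    have "Lp_norm p M h * (c * F_norm q M P t g) \<le> Lp_norm p M h * (c * 1)"
      using g c by (intro mult_left_mono) auto
    with pairing_le_F_norm[OF g(1)] show "cmod (pairing M h g) \<le> Lp_norm p M h * (c * 1)" by linarith
  qed
qed (use assms in simp)

text \<open>The zero function lies in the unit ball over which the supremum is taken.\<close>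

lemma F_dual_norm_nonneg: "0 \<le> F_dual_norm q M P t h"
proof -
  have "F_enorm q M P t (\<lambda>\<omega>. 0) \<le> ennreal 0"
    using F_enorm_cmult[OF Lp_zero, of t 0] by simp
  note zero = F_spaceI[OF Lp_zero this]
  have "cmod (pairing M h (\<lambda>\<omega>. 0)) \<le> F_dual_norm q M P t h"
    using zero by (intro pairing_le_F_dual_norm_unit) auto
  then show ?thesis by (rule order_trans[OF norm_ge_zero])
qed

text \<open>Scaling \<open>g\<close> to norm 1 reduces this to the unit ball. If its norm is 0, the
  embedding already makes the pairing vanish.\<close>

lemma pairing_le_F_dual_norm:
  assumes g: "g \<in> F_space q M P t"
  shows "cmod (pairing M h g) \<le> F_dual_norm q M P t h * F_norm q M P t g"
proof (cases "F_norm q M P t g = 0")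
  case True
  then show ?thesis using pairing_le_F_norm[OF g] by simp
next
  case False
  define F where "F = F_norm q M P t g"
  have F: "0 < F"
    using False F_norm_nonneg[of t g] unfolding F_def by linarith
  let ?g = "\<lambda>\<omega>. of_real (1 / F) * g \<omega>"
  have "F_enorm q M P t ?g = ennreal (1 / F) * ennreal F"
    using F F_enorm_cmult[OF F_space_Lp[OF g], of t "of_real (1 / F)"] ennreal_F_norm[OF g]
    by (simp add: F_def norm_divide)
  also have "\<dots> = ennreal 1"
    using F by (simp add: ennreal_mult[symmetric])
  finally have "?g \<in> F_space q M P t" "F_norm q M P t ?g \<le> 1"
    using F_spaceI[OF Lp_cmult[OF F_space_Lp[OF g], of "of_real (1 / F)"], of t 1] by simp_all
  then have "cmod (pairing M h ?g) \<le> F_dual_norm q M P t h"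
    by (rule pairing_le_F_dual_norm_unit)
  also have "pairing M h ?g = of_real (1 / F) * pairing M h g"
    unfolding pairing_def using integral_mult_right_zero[of M "of_real (1/F)" "\<lambda>\<omega>. h \<omega> * cnj (g \<omega>)"]
    by (simp add: mult_ac)
  finally show ?thesis
    using F by (simp add: norm_divide F_def[symmetric] field_simps)
qed

end

section \<open>Splitting into low and high frequencies\<close>

definition split_const :: real
  where "split_const = 4 * (1 + 8 * (4 * (1 + 192 * K)))"

lemma split_const_ge_1: "1 \<le> split_const"
  using K(1) unfolding split_const_def by simp

text \<open>Components beyond \<open>Suc m\<close> vanish, those below \<open>m\<close> are
  components of \<open>f\<close>, and for indices up to \<open>Suc m\<close> the ratio of the
  weights of index \<open>t\<close> and \<open>t'\<close> is at most its value at
  \<open>Suc m\<close>.\<close>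

lemma partial_sum_F_norm_le:
  assumes f: "f \<in> F_space q M P t'" and t: "t' \<le> t"
  shows "partial_sum (Suc m) f \<in> F_space q M P t"
    and "F_norm q M P t (partial_sum (Suc m) f)
      \<le> split_const * 2 powr (real (Suc m) * (t - t')) * F_norm q M P t' f"
proof -
  \<comment> \<open>\<open>?A\<close> is the weight ratio at the highest surviving index.
    \<open>?B\<close> exceeds the \<open>192 * K\<close> called for here; it is the factor that the
    remainder requires, so that \<open>split_const\<close>, which is
    \<open>4 * (1 + 8 * ?B)\<close>, fits both estimates.\<close>
  let ?A = "2 powr (real (Suc m) * (t - t'))" and ?B = "4 * (1 + 192 * K)"
  note fL = F_space_Lp[OF f]
  note S = partial_sum_Lp[OF fL, of "Suc m"]
  have w: "2 powr (real j * t) \<le> ?A * 2 powr (real j * t')" if "j \<le> Suc m" for j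
  proof -
    have "real j * (t - t') \<le> real (Suc m) * (t - t')"
      using that t by (intro mult_right_mono) auto
    then show ?thesis by (simp add: powr_add[symmetric] algebra_simps)
  qed
  have off: "AE \<omega> in M. 2 powr (real j * t) * cmod (P j (partial_sum (Suc m) f) \<omega>)
      \<le> ?A * (2 powr (real j * t') * cmod (P j f \<omega>))" if "j \<noteq> m" "j \<noteq> Suc m" for j
  proof (cases "j < m")
    case True
    then have "AE \<omega> in M. P j (partial_sum (Suc m) f) \<omega> = P j f \<omega>"
      by (intro P_partial_sum_low fL) simp
    then show ?thesis
    proof eventually_elim
      case (elim \<omega>)
      then show ?case using mult_right_mono[OF w[of j], of "cmod (P j f \<omega>)"] True
        by (simp only: mult.assoc) simp
    qed
  next
    case False
    then have "AE \<omega> in M. P j (partial_sum (Suc m) f) \<omega> = 0"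
      using that by (intro P_partial_sum_high fL) simp
    then show ?thesis by eventually_elim simp
  qed
  have diag: "2 powr (real j * t) * Lp_norm q M (P j (partial_sum (Suc m) f))
      \<le> ?B * ?A * (2 powr (real j * t') * Lp_norm q M (P j f))" if "j = m \<or> j = Suc m" for j
  proof -
    have "192 * K * Lp_norm q M (P j f) \<le> ?B * Lp_norm q M (P j f)"
      using K(1) by (intro mult_right_mono) auto
    then have "2 powr (real j * t) * Lp_norm q M (P j (partial_sum (Suc m) f))
        \<le> (?A * 2 powr (real j * t')) * (?B * Lp_norm q M (P j f))"
      using P_partial_sum_bound[OF fL, of j "Suc m"] K(1) w[of j] that by (intro mult_mono) auto
    then show ?thesis by (simp only: mult_ac)
  qed
  have "F_enorm q M P t (partial_sum (Suc m) f) \<le> ennreal (split_const * ?A) * F_enorm q M P t' f"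
    unfolding split_const_def using K(1) off diag by (intro F_enorm_compare[OF S fL]) auto
  also have "\<dots> = ennreal (split_const * ?A * F_norm q M P t' f)"
    using split_const_ge_1 unfolding ennreal_F_norm[OF f, symmetric]
    by (intro ennreal_mult[symmetric]) auto
  finally have le: "F_enorm q M P t (partial_sum (Suc m) f) \<le> ennreal (split_const * ?A * F_norm q M P t' f)" .
  have "0 \<le> split_const * ?A * F_norm q M P t' f"
    using split_const_ge_1 by (intro mult_nonneg_nonneg) auto
  from F_spaceI[OF S le this] show "partial_sum (Suc m) f \<in> F_space q M P t"
    and "F_norm q M P t (partial_sum (Suc m) f) \<le> split_const * ?A * F_norm q M P t' f"
    by auto
qed

text \<open>The components of the remainder below \<open>m\<close> vanish, and beyond
  \<open>Suc m\<close> they are those of \<open>f\<close>, whose weights are at least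
  \<open>2 powr (real m * t)\<close>. The comparison is made with index 0, and the embedding turns
  it into a Lebesgue norm at the cost of the factor \<open>c\<close>.\<close>

lemma tail_Lp_norm_le:
  assumes f: "f \<in> F_space q M P t" and t: "0 \<le> t"
  shows "Lp_norm q M (\<lambda>\<omega>. f \<omega> - partial_sum (Suc m) f \<omega>)
      \<le> c * split_const * 2 powr (- (real m * t)) * F_norm q M P t f"
proof -
  let ?A = "2 powr (- (real m * t))" and ?B = "4 * (1 + 192 * K)"
  let ?R = "\<lambda>\<omega>. f \<omega> - partial_sum (Suc m) f \<omega>"
  note fL = F_space_Lp[OF f]
  note S = partial_sum_Lp[OF fL, of "Suc m"]
  have R: "?R \<in> Lp q M"
    using q by (intro Lp_diff fL S) simp
  have w: "1 \<le> ?A * 2 powr (real j * t)" if "m \<le> j" for j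
  proof -
    have "real m * t \<le> real j * t"
      using that t by (intro mult_right_mono) auto
    then show ?thesis by (simp add: powr_add[symmetric] ge_one_powr_ge_zero)
  qed
  have off: "AE \<omega> in M. 2 powr (real j * 0) * cmod (P j ?R \<omega>)
      \<le> ?A * (2 powr (real j * t) * cmod (P j f \<omega>))" if "j \<noteq> m" "j \<noteq> Suc m" for j
  proof (cases "j < m")
    case True
    then have "AE \<omega> in M. P j (partial_sum (Suc m) f) \<omega> = P j f \<omega>"
      by (intro P_partial_sum_low fL) simp
    with P_diff[OF fL S, of j] show ?thesis by eventually_elim simp
  next
    case False
    then have "AE \<omega> in M. P j (partial_sum (Suc m) f) \<omega> = 0"
      using that by (intro P_partial_sum_high fL) simp
    with P_diff[OF fL S, of j] show ?thesis
    proof eventually_elim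
      case (elim \<omega>)
      then show ?case using mult_right_mono[OF w[of j], of "cmod (P j f \<omega>)"] False
        by (simp add: mult.assoc)
    qed
  qed
  \<comment> \<open>The triangle inequality for \<open>P j f\<close> minus the component of the
    partial sum gives the factor \<open>4 * (1 + 192 * K)\<close>.\<close>
  have diag: "2 powr (real j * 0) * Lp_norm q M (P j ?R)
      \<le> ?B * ?A * (2 powr (real j * t) * Lp_norm q M (P j f))" if "j = m \<or> j = Suc m" for j
  proof -
    let ?S = "P j (partial_sum (Suc m) f)"
    have PS: "(\<lambda>\<omega>. - 1 * ?S \<omega>) \<in> Lp q M"
      by (intro Lp_cmult P_Lp S)
    have "Lp_norm q M (P j ?R) = Lp_norm q M (\<lambda>\<omega>. P j f \<omega> + - 1 * ?S \<omega>)"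
      using P_diff[OF fL S, of j] q
      by (intro Lp_norm_cong_AE Lp_measurable[where q = q] P_Lp R Lp_add PS fL) auto
    also have "\<dots> \<le> 4 * (Lp_norm q M (P j f) + Lp_norm q M (\<lambda>\<omega>. - 1 * ?S \<omega>))"
      using q by (intro Lp_add P_Lp fL PS) simp
    also have "Lp_norm q M (\<lambda>\<omega>. - 1 * ?S \<omega>) = Lp_norm q M ?S"
      by (simp add: Lp_norm_def)
    also have "4 * (Lp_norm q M (P j f) + Lp_norm q M ?S) \<le> ?B * Lp_norm q M (P j f)"
      using P_partial_sum_bound[OF fL, of j "Suc m"] by (simp add: algebra_simps)
    finally have "1 * Lp_norm q M (P j ?R) \<le> (?A * 2 powr (real j * t)) * (?B * Lp_norm q M (P j f))"
      using w[of j] that by (intro mult_mono) auto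
    then show ?thesis by (simp add: mult_ac)
  qed
  have "F_enorm q M P 0 ?R \<le> ennreal (split_const * ?A) * F_enorm q M P t f"
    unfolding split_const_def using K(1) off diag by (intro F_enorm_compare[OF R fL]) auto
  also have "\<dots> = ennreal (split_const * ?A * F_norm q M P t f)"
    using split_const_ge_1 unfolding ennreal_F_norm[OF f, symmetric]
    by (intro ennreal_mult[symmetric]) auto
  finally have le: "F_enorm q M P 0 ?R \<le> ennreal (split_const * ?A * F_norm q M P t f)" .
  have "0 \<le> split_const * ?A * F_norm q M P t f"
    using split_const_ge_1 by (intro mult_nonneg_nonneg) auto
  note FR = F_spaceI[OF R le this]
  have "Lp_norm q M ?R \<le> c * F_norm q M P 0 ?R"
    by (rule Lp_norm_le_F_norm[OF FR(1)]) simp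
  also have "\<dots> \<le> c * (split_const * ?A * F_norm q M P t f)"
    using c by (intro mult_left_mono FR(2)) simp
  finally show ?thesis by (simp add: mult.assoc)
qed

lemma pairing_split_le:
  assumes p: "1 < p" "1/p + 1/q = 1" and h: "h \<in> Lp p M"
    and f: "f \<in> F_space q M P t'" and t: "0 \<le> t'" "t' \<le> t"
  shows "cmod (pairing M h f) \<le>
      F_dual_norm q M P t h * (split_const * 2 powr (real (Suc m) * (t - t')) * F_norm q M P t' f)
      + Lp_norm p M h * (c * split_const * 2 powr (- (real m * t')) * F_norm q M P t' f)"
proof -
  let ?S = "partial_sum (Suc m) f"
  let ?R = "\<lambda>\<omega>. f \<omega> - ?S \<omega>"
  note fL = F_space_Lp[OF f]
  note S = partial_sum_F_norm_le[OF f t(2), of m]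
  have R: "?R \<in> Lp q M"
    using q by (intro Lp_diff fL partial_sum_Lp) auto
  have "pairing M h f = pairing M h ?S + pairing M h ?R"
    unfolding pairing_def
      Bochner_Integration.integral_add[OF Holder_inequality(1)[OF p(1) q p(2) h F_space_Lp[OF S(1)]]
        Holder_inequality(1)[OF p(1) q p(2) h R], symmetric]
    by (simp add: algebra_simps)
  then have "cmod (pairing M h f) \<le> cmod (pairing M h ?S) + cmod (pairing M h ?R)"
    by (simp add: norm_triangle_ineq)
  also have "\<dots> \<le> F_dual_norm q M P t h * F_norm q M P t ?S + Lp_norm p M h * Lp_norm q M ?R"
    using t by (intro add_mono pairing_le_F_dual_norm[OF p h _ S(1)] Holder_inequality(2)[OF p(1) q p(2) h R]) simp
  also have "\<dots> \<le> F_dual_norm q M P t h * (split_const * 2 powr (real (Suc m) * (t - t')) * F_norm q M P t' f)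
      + Lp_norm p M h * (c * split_const * 2 powr (- (real m * t')) * F_norm q M P t' f)"
    using t by (intro add_mono mult_left_mono S(2) tail_Lp_norm_le f F_dual_norm_nonneg[OF p h]) auto
  finally show ?thesis .
qed

text \<open>The integer cut-off is replaced by a real parameter \<open>l\<close>, with
  \<open>m * \<theta>\<close> close to \<open>l\<close>; the rounding costs the factor
  \<open>2 powr \<theta>\<close>.\<close>

lemma pairing_interpolation:
  assumes p: "1 < p" "1/p + 1/q = 1" and h: "h \<in> Lp p M"
    and f: "f \<in> F_space q M P (s * \<theta>)"
    and \<theta>: "0 \<le> \<theta>" and s: "0 < s" "s \<le> 1" and l: "0 \<le> l"
  shows "cmod (pairing M h f) \<le> c * split_const * 2 powr \<theta> * F_norm q M P (s * \<theta>) f *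
    (2 powr ((l + 1) * (1 - s)) * F_dual_norm q M P \<theta> h + 2 powr (- (l * s)) * Lp_norm p M h)"
proof -
  let ?d = "F_dual_norm q M P \<theta> h" and ?N = "F_norm q M P (s * \<theta>) f" and ?h = "Lp_norm p M h"
  let ?u = "2 powr ((l + 1) * (1 - s))" and ?v = "2 powr (- (l * s))"
  have d: "0 \<le> ?d" by (rule F_dual_norm_nonneg[OF p h \<theta>])
  have split: "0 \<le> split_const" "split_const \<le> c * split_const"
    using split_const_ge_1 c by auto
  show ?thesis
  proof (cases "\<theta> = 0")
    case True
    \<comment> \<open>For \<theta> zero both indices coincide: the dual norm alone bounds the
      pairing, and all factors in front of it on the right are at least 1.\<close>
    have "1 \<le> c * split_const"
      using split_const_ge_1 split(2) by linarith
    moreover have "1 \<le> ?u"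
      using s l by (intro ge_one_powr_ge_zero) auto
    ultimately have "1 * (1 * ?d) \<le> c * split_const * (?u * ?d)"
      using d by (intro mult_mono mult_right_mono) auto
    also have "\<dots> \<le> c * split_const * (?u * ?d + ?v * ?h)"
      using c split_const_ge_1 by (intro mult_left_mono) auto
    finally have "?d * ?N \<le> c * split_const * (?u * ?d + ?v * ?h) * ?N"
      by (intro mult_right_mono) auto
    moreover have "cmod (pairing M h f) \<le> ?d * ?N"
      using f True pairing_le_F_dual_norm[OF p h \<theta>, of f] by simp
    ultimately show ?thesis using True by (simp add: mult_ac)
  next
    case False
    then have \<theta>_pos: "0 < \<theta>" using \<theta> by simp
    \<comment> \<open>Then \<open>m * \<theta> \<le> l\<close>, which limits the growth of the
      low-frequency part, and \<open>l \<le> m * \<theta> + \<theta>\<close>, which gives the decay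
      of the remainder.\<close>
    define m where "m = nat \<lfloor>l / \<theta>\<rfloor>"
    have "real m \<le> l / \<theta>" "l / \<theta> < real m + 1"
      using l \<theta> unfolding m_def by (simp_all add: of_nat_nat)
    then have m: "real m * \<theta> \<le> l" "l \<le> real m * \<theta> + \<theta>"
      using \<theta>_pos by (simp_all add: field_simps)
    have "real (Suc m) * (\<theta> - s * \<theta>) \<le> \<theta> + (l + 1) * (1 - s)"
    proof -
      have "real (Suc m) * (\<theta> - s * \<theta>) = real m * \<theta> * (1 - s) + \<theta> * (1 - s)"
        by (simp add: algebra_simps)
      also have "\<dots> \<le> l * (1 - s) + \<theta> * 1"
        using m s \<theta> by (intro add_mono mult_right_mono mult_left_mono) auto
      finally show ?thesis using s by (simp add: algebra_simps)
    qed
    then have u: "2 powr (real (Suc m) * (\<theta> - s * \<theta>)) \<le> 2 powr \<theta> * ?u"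
      by (simp add: powr_add[symmetric])
    have "- (real m * (s * \<theta>)) \<le> \<theta> - l * s"
    proof -
      have "l * s \<le> (real m * \<theta> + \<theta>) * s"
        using m s by (intro mult_right_mono) auto
      also have "\<dots> \<le> real m * (s * \<theta>) + \<theta>"
        using s \<theta> mult_left_mono[of s 1 \<theta>] by (simp add: algebra_simps)
      finally show ?thesis by simp
    qed
    then have v: "2 powr (- (real m * (s * \<theta>))) \<le> 2 powr \<theta> * ?v"
      by (simp add: powr_add[symmetric])
    have "cmod (pairing M h f) \<le>
      ?d * (split_const * 2 powr (real (Suc m) * (\<theta> - s * \<theta>)) * ?N)
      + ?h * (c * split_const * 2 powr (- (real m * (s * \<theta>))) * ?N)"
      using s \<theta> mult_right_mono[of s 1 \<theta>] by (intro pairing_split_le[OF p h f]) auto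
    also have "\<dots> \<le> ?d * (c * split_const * (2 powr \<theta> * ?u) * ?N) + ?h * (c * split_const * (2 powr \<theta> * ?v) * ?N)"
      using d split u v by (intro add_mono mult_left_mono mult_right_mono mult_mono) auto
    finally show ?thesis by (simp add: algebra_simps)
  qed
qed

end

section \<open>The variational source condition\<close>

theorem theorem3p3:
  fixes M :: "'a measure" and p q ph qh :: real
    and P :: "nat \<Rightarrow> ('a \<Rightarrow> complex) \<Rightarrow> 'a \<Rightarrow> complex"
    and D :: "('a \<Rightarrow> real) set" and T :: "('a \<Rightarrow> real) \<Rightarrow> 'y::banach" and y :: 'y
    and xstar xdag fdag :: "'a \<Rightarrow> real"
    and \<Psi>0 :: "real \<Rightarrow> real" and \<theta> s cp :: real
  assumes "sigma_finite_measure M"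
    and "1 < p" and "q = p / (p - 1)" and "ph = max p 2" and "qh = min q 2"
    and "LP_decomposition q M P"
    and "Lp_closed p M D" and "Lp_convex D"
    and "weakly_seq_continuous p M D T"
    and "xstar \<in> Lp p M"
    and "min_norm_solution p M D T y xstar xdag"
    and "uniform_convexity_constant ph p M cp"
    and "concave_index_function \<Psi>0" and "\<theta> \<ge> 0"
    and "\<exists>K>0. \<forall>x\<in>D. F_dual_norm q M P \<theta> (\<lambda>\<omega>. complex_of_real (xdag \<omega> - x \<omega>))
           \<le> K * extend0 \<Psi>0 (norm (T xdag - T x))"
    and "fdag = duality_map ph p M (\<lambda>\<omega>. xdag \<omega> - xstar \<omega>)"
    and "\<not> (AE \<omega> in M. fdag \<omega> = 0)"
    and "0 < s" and "s \<le> 1"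
    and "(\<lambda>\<omega>. complex_of_real (fdag \<omega>)) \<in> F_space q M P (s * \<theta>)"
  shows "\<exists>C0>0. \<forall>C\<ge>C0.
    (let N = (\<lambda>t. F_norm q M P t (\<lambda>\<omega>. complex_of_real (fdag \<omega>)));
         \<Psi> = (\<lambda>\<delta>::real. if s = 1 then C * N \<theta> * \<Psi>0 \<delta>
               else C * (INF l\<in>{1::real..}.
                  1 / 2 powr (l * qh * s) * N (s * \<theta>) powr qh
                    + 2 powr ((l + 1) * (1 - s)) * N (s * \<theta>) * \<Psi>0 \<delta>));
         \<beta> = cp / 2
     in concave_index_function \<Psi> \<and>
        (\<forall>x\<in>D. real_pairing M (\<lambda>\<omega>. xdag \<omega> - x \<omega>) (duality_map ph p M (\<lambda>\<omega>. xdag \<omega> - xstar \<omega>))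
           \<le> (cp - \<beta>) / ph * Lp_norm p M (\<lambda>\<omega>. x \<omega> - xdag \<omega>) powr ph
             + extend0 \<Psi> (norm (T x - T xdag))) \<and>
        (\<exists>K>0. \<forall>\<^sub>F \<delta> in at_right 0. \<Psi> \<delta> \<le> K * \<Psi>0 \<delta> powr (qh * s / (1 + (qh - 1) * s))))"
proof -
  note p = \<open>1 < p\<close> and s = \<open>0 < s\<close> \<open>s \<le> 1\<close> and \<theta> = \<open>\<theta> \<ge> 0\<close>
  note index = \<open>concave_index_function \<Psi>0\<close>
  have q1: "1 < q" and conj: "1 / p + 1 / q = 1"
    using p unfolding \<open>q = p / (p - 1)\<close> by (auto simp: divide_simps)
  \<comment> \<open>Since \<open>p \<le> 2\<close> exactly when \<open>2 \<le> q\<close>, maximum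
    and minimum switch together: the pair is (2, 2) or (p, q), conjugate in both cases.\<close>
  have hat: "1 < ph" "1 < qh" "1 / ph + 1 / qh = 1"
  proof -
    have "p \<le> 2 \<longleftrightarrow> 2 \<le> q"
      using p unfolding \<open>q = p / (p - 1)\<close> by (auto simp: divide_simps)
    then show "1 < ph" "1 < qh" "1 / ph + 1 / qh = 1"
      using p q1 conj unfolding \<open>ph = max p 2\<close> \<open>qh = min q 2\<close> by (auto simp: max_def min_def)
  qed
  have cp: "0 < cp"
    using \<open>uniform_convexity_constant ph p M cp\<close> unfolding uniform_convexity_constant_def by simp
  obtain K c where "Littlewood_Paley q M P K c"
    using LP_decomposition_Littlewood_Paley[OF \<open>LP_decomposition q M P\<close> q1] .
  then interpret Littlewood_Paley q M P K c .
  obtain K0 where K0: "0 < K0" "\<And>x. x \<in> D \<Longrightarrow> F_dual_norm q M P \<theta> (\<lambda>\<omega>. complex_of_real (xdag \<omega> - x \<omega>))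
      \<le> K0 * extend0 \<Psi>0 (norm (T xdag - T x))"
    using assms(15) by blast
  define f where "f = (\<lambda>\<omega>. complex_of_real (fdag \<omega>))"
  define N where "N = F_norm q M P (s * \<theta>) f"
  have f: "f \<in> F_space q M P (s * \<theta>)"
    using assms(20) unfolding f_def .
  have N: "0 < N"
    unfolding N_def using \<open>\<not> (AE \<omega> in M. fdag \<omega> = 0)\<close> s \<theta>
    by (intro F_norm_pos f) (auto simp: f_def)
  have \<Psi>0_pos: "0 < \<Psi>0 \<delta>" if "0 < \<delta>" for \<delta>
    using index that unfolding concave_index_function_def index_function_def by blast
  \<comment> \<open>\<open>a l\<close> and \<open>b l\<close> are intercept and slope of the affine
    functions of \<open>\<Psi>0 \<delta>\<close> under the infimum. For \<open>s = 1\<close> the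
    number \<open>N\<close> is the norm of index \<theta>.\<close>
  define a where "a l = 1 / 2 powr (l * qh * s) * N powr qh" for l
  define b where "b l = 2 powr ((l + 1) * (1 - s)) * N" for l
  define \<Psi>1 where "\<Psi>1 C \<delta> = (if s = 1 then C * N * \<Psi>0 \<delta>
      else C * (INF l\<in>{1..}. a l + b l * \<Psi>0 \<delta>))" for C \<delta>
  have a_nonneg: "0 \<le> a l" for l
    unfolding a_def by simp
  have a_small: "\<exists>l\<in>{1..}. a l < e" if "0 < e" for e
  proof -
    \<comment> \<open>Chosen so that \<open>2 powr (l * qh * s)\<close> exceeds
      \<open>N powr qh / e\<close>; the added 1 makes the inequality strict.\<close>
    define l where "l = max 1 ((log 2 (N powr qh / e) + 1) / (qh * s))"
    have k: "0 < qh * s" using hat s by simp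
    have "N powr qh / e = 2 powr log 2 (N powr qh / e)"
      using N that by simp
    also have "\<dots> < 2 powr (l * qh * s)"
    proof (rule powr_less_mono)
      have "(log 2 (N powr qh / e) + 1) / (qh * s) \<le> l"
        unfolding l_def by simp
      then have "log 2 (N powr qh / e) + 1 \<le> l * (qh * s)"
        using k by (simp only: pos_divide_le_eq)
      then show "log 2 (N powr qh / e) < l * qh * s"
        by (simp add: mult.assoc)
    qed simp
    finally have "a l < e"
      using that unfolding a_def by (simp add: field_simps)
    then show ?thesis unfolding l_def by force
  qed
  \<comment> \<open>As \<open>(l + 1) * (1 - s)\<close> is nonnegative, \<open>N\<close> is a
    positive lower bound for all slopes, as strict monotonicity of the infimum requires.\<close>
  have b_ge: "N \<le> b l" if "l \<in> {1..}" for l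
    unfolding b_def using N s that by (simp add: ge_one_powr_ge_zero)
  define E where "E = c * split_const * 2 powr \<theta>"
  have E: "0 < E"
    using c split_const_ge_1 unfolding E_def by (intro mult_pos_pos) auto
  \<comment> \<open>Second coefficient of Young's inequality with weight \<open>cp / 2\<close>; the
    first one is then \<open>cp / 2 / ph\<close>, the coefficient of the norm term for
    \<open>\<beta> = cp / 2\<close>.\<close>
  define Y where "Y = (cp / 2) powr (- qh / ph) / qh"
  have Y: "0 < Y" using cp hat unfolding Y_def by simp
  \<comment> \<open>The larger of the coefficients that arise before \<open>b l * t x\<close> and
    \<open>a l\<close>, independent of \<open>x\<close> and \<open>l\<close>.\<close>
  define C1 where "C1 = max (E * K0) (Y * E powr qh)"
  have Dp: "D \<subseteq> Lp p M"
    using \<open>Lp_closed p M D\<close> unfolding Lp_closed_def by simp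
  have xdag: "xdag \<in> D"
    using \<open>min_norm_solution p M D T y xstar xdag\<close> unfolding min_norm_solution_def by simp
  define t where "t x = extend0 \<Psi>0 (norm (T x - T xdag))" for x
  define h where "h x = (\<lambda>\<omega>. complex_of_real (xdag \<omega> - x \<omega>))" for x
  have t: "0 \<le> t x" for x
    using \<Psi>0_pos[of "norm (T x - T xdag)"] unfolding t_def extend0_def by (auto simp: less_imp_le)
  have h: "h x \<in> Lp p M" if "x \<in> D" for x
    using Lp_diff[of xdag p M x] p that Dp xdag unfolding h_def by (intro Lp_of_real) auto
  have d: "F_dual_norm q M P \<theta> (h x) \<le> K0 * t x" if "x \<in> D" for x
    using K0(2)[OF that] unfolding h_def t_def by (simp add: norm_minus_commute)
  have pairing: "real_pairing M (\<lambda>\<omega>. xdag \<omega> - x \<omega>) fdag \<le> cmod (pairing M (h x) f)" for x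
    unfolding h_def f_def pairing_of_real by simp
  have vsc: "real_pairing M (\<lambda>\<omega>. xdag \<omega> - x \<omega>) fdag
      \<le> cp / 2 / ph * Lp_norm p M (\<lambda>\<omega>. x \<omega> - xdag \<omega>) powr ph + C1 * (a l + b l * t x)"
    if x: "x \<in> D" and l: "1 \<le> l" for x l
  proof -
    let ?u = "2 powr ((l + 1) * (1 - s))" and ?v = "2 powr (- (l * s))" and ?h = "Lp_norm p M (h x)"
    have "cmod (pairing M (h x) f) \<le> E * N * (?u * F_dual_norm q M P \<theta> (h x) + ?v * ?h)"
      unfolding E_def N_def using l by (intro pairing_interpolation p conj h[OF x] f \<theta> s) simp
    also have "\<dots> \<le> E * N * (?u * (K0 * t x) + ?v * ?h)"
      using E N d[OF x] by (intro mult_left_mono add_mono) auto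
    also have "\<dots> = E * K0 * (b l * t x) + ?h * (E * N * ?v)"
      unfolding b_def by (simp add: algebra_simps)
    also have "?h * (E * N * ?v) \<le> cp / 2 / ph * ?h powr ph + Y * (E * N * ?v) powr qh"
      unfolding Y_def using E N cp by (intro Youngs_inequality_eps hat) auto
    \<comment> \<open>The power \<open>qh\<close> turns \<open>N * ?v\<close>, the size of the
      high-frequency part, into the intercept \<open>a l\<close>.\<close>
    also have "(E * N * ?v) powr qh = E powr qh * a l"
    proof -
      have "(E * N * ?v) powr qh = E powr qh * N powr qh * 2 powr (- (l * qh * s))"
        using E N by (simp add: powr_mult powr_powr mult_ac)
      then show ?thesis unfolding a_def by (simp add: powr_minus divide_simps)
    qed
    also have "E * K0 * (b l * t x) + (cp / 2 / ph * ?h powr ph + Y * (E powr qh * a l))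
        \<le> C1 * (b l * t x) + (cp / 2 / ph * ?h powr ph + C1 * a l)"
      using a_nonneg[of l] t[of x] N unfolding C1_def b_def mult.assoc[symmetric, of Y]
      by (intro add_mono mult_right_mono order_refl) auto
    finally have "cmod (pairing M (h x) f)
        \<le> cp / 2 / ph * ?h powr ph + C1 * (a l + b l * t x)"
      by (simp add: algebra_simps)
    moreover have "?h = Lp_norm p M (\<lambda>\<omega>. x \<omega> - xdag \<omega>)"
      unfolding Lp_norm_def h_def by (simp only: norm_of_real real_norm_def abs_minus_commute)
    ultimately show ?thesis using pairing[of x] by simp
  qed
  \<comment> \<open>For \<open>s = 1\<close> the function \<open>f\<close> lies in the space of
    index \<theta> itself, so the stability estimate applies without splitting.\<close>
  have vsc1: "real_pairing M (\<lambda>\<omega>. xdag \<omega> - x \<omega>) fdag \<le> K0 * N * t x" if x: "x \<in> D" and "s = 1" for x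
  proof -
    have "cmod (pairing M (h x) f) \<le> F_dual_norm q M P \<theta> (h x) * N"
      using pairing_le_F_dual_norm[OF p conj h[OF x] \<theta>, of f] f \<open>s = 1\<close> unfolding N_def by simp
    also have "\<dots> \<le> K0 * t x * N"
      using N d[OF x] by (intro mult_right_mono) auto
    finally show ?thesis using pairing[of x] by (simp add: mult_ac)
  qed
  \<comment> \<open>\<open>C1\<close> serves the case \<open>s < 1\<close>, and \<open>K0\<close>
    serves \<open>s = 1\<close>.\<close>
  define C0 where "C0 = max C1 K0"
  have "concave_index_function (\<Psi>1 C)
      \<and> (\<forall>x\<in>D. real_pairing M (\<lambda>\<omega>. xdag \<omega> - x \<omega>) fdag
          \<le> (cp - cp / 2) / ph * Lp_norm p M (\<lambda>\<omega>. x \<omega> - xdag \<omega>) powr ph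
            + extend0 (\<Psi>1 C) (norm (T x - T xdag)))
      \<and> (\<exists>K>0. \<forall>\<^sub>F \<delta> in at_right 0. \<Psi>1 C \<delta> \<le> K * \<Psi>0 \<delta> powr (qh * s / (1 + (qh - 1) * s)))"
    if C: "C0 \<le> C" for C
  proof -
    have C_ge: "C1 \<le> C" "K0 \<le> C" using C unfolding C0_def by auto
    have C_pos: "0 < C" using C_ge K0 by simp
    have "concave_index_function (\<Psi>1 C)"
    proof (cases "s = 1")
      case True
      then show ?thesis
        using concave_index_function_cmult[OF index, of "C * N"] C_pos N unfolding \<Psi>1_def[abs_def] by simp
    next
      case False
      have "concave_index_function (\<lambda>\<delta>. C * (INF l\<in>{1..}. a l + b l * \<Psi>0 \<delta>))"
        by (intro concave_index_function_cmult C_pos concave_index_function_INF[OF index _ _ N]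
            a_nonneg a_small b_ge)
      with False show ?thesis unfolding \<Psi>1_def[abs_def] by simp
    qed
    moreover have "real_pairing M (\<lambda>\<omega>. xdag \<omega> - x \<omega>) fdag
          \<le> (cp - cp / 2) / ph * Lp_norm p M (\<lambda>\<omega>. x \<omega> - xdag \<omega>) powr ph
            + extend0 (\<Psi>1 C) (norm (T x - T xdag))" if x: "x \<in> D" for x
    proof (cases "s = 1")
      case True
      have "K0 * N * t x \<le> C * N * t x"
        using C_ge N t[of x] by (intro mult_right_mono) auto
      also have "\<dots> = extend0 (\<Psi>1 C) (norm (T x - T xdag))"
        using True unfolding \<Psi>1_def t_def extend0_def by simp
      finally have "real_pairing M (\<lambda>\<omega>. xdag \<omega> - x \<omega>) fdag \<le> extend0 (\<Psi>1 C) (norm (T x - T xdag))"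
        using vsc1[OF x True] by simp
      moreover have "0 \<le> (cp - cp / 2) / ph * Lp_norm p M (\<lambda>\<omega>. x \<omega> - xdag \<omega>) powr ph"
        using cp hat by simp
      ultimately show ?thesis by simp
    next
      case False
      \<comment> \<open>The bound by \<open>C * (a l + b l * t x)\<close> holds for each
        \<open>l\<close>; dividing by the positive \<open>C\<close> makes \<open>?r / C\<close> a
        lower bound of the family under the infimum.\<close>
      let ?r = "(real_pairing M (\<lambda>\<omega>. xdag \<omega> - x \<omega>) fdag - cp / 2 / ph * Lp_norm p M (\<lambda>\<omega>. x \<omega> - xdag \<omega>) powr ph)"
      have "?r / C \<le> (INF l\<in>{1..}. a l + b l * t x)"
      proof (rule cINF_greatest)
        fix l :: real
        assume l: "l \<in> {1..}"
        have "C1 * (a l + b l * t x) \<le> C * (a l + b l * t x)"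
          using C_ge a_nonneg[of l] t[of x] N b_ge[OF l]
          by (intro mult_right_mono add_nonneg_nonneg mult_nonneg_nonneg) auto
        then have "?r \<le> C * (a l + b l * t x)"
          using vsc[OF x, of l] l by simp
        then show "?r / C \<le> a l + b l * t x"
          using C_pos by (simp add: pos_divide_le_eq mult.commute)
      qed simp
      then have "?r \<le> C * (INF l\<in>{1..}. a l + b l * t x)"
        using C_pos by (simp add: pos_divide_le_eq mult.commute)
      \<comment> \<open>If the images under \<open>T\<close> coincide, \<open>t x\<close> is 0 and
        the infimum is that of the \<open>a l\<close>, namely 0, as the extension
        prescribes.\<close>
      also have "\<dots> = extend0 (\<Psi>1 C) (norm (T x - T xdag))"
        using False INF_eq_0[of "{1..}" a, OF a_nonneg a_small] unfolding \<Psi>1_def t_def extend0_def by simp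
      finally show ?thesis by simp
    qed
    moreover have "\<exists>K>0. \<forall>\<^sub>F \<delta> in at_right 0. \<Psi>1 C \<delta> \<le> K * \<Psi>0 \<delta> powr (qh * s / (1 + (qh - 1) * s))"
    proof (cases "s = 1")
      case True
      \<comment> \<open>For \<open>s = 1\<close> the exponent on the right is 1, so both sides
        agree.\<close>
      have "\<forall>\<^sub>F \<delta> in at_right 0. \<Psi>1 C \<delta> \<le> (C * N) * \<Psi>0 \<delta> powr (qh * s / (1 + (qh - 1) * s))"
        using eventually_at_right_less[of 0]
      proof eventually_elim
        case (elim \<delta>)
        then show ?case using True hat \<Psi>0_pos[OF elim] unfolding \<Psi>1_def by simp
      qed
      then show ?thesis using C_pos N by (intro exI[of _ "C * N"]) simp
    next
      case False
      let ?K = "C * (N powr qh + 2 powr (1 - s) * N)"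
      have "(\<Psi>0 \<longlongrightarrow> 0) (at_right 0)"
        using index unfolding concave_index_function_def index_function_def by blast
      \<comment> \<open>This threshold makes the balancing parameter at least 1, so that it is
        admissible in the infimum.\<close>
      then have "\<forall>\<^sub>F \<delta> in at_right 0. \<Psi>0 \<delta> < 2 powr (- (1 + (qh - 1) * s))"
        by (rule order_tendstoD(2)) simp
      with eventually_at_right_less[of 0]
      have "\<forall>\<^sub>F \<delta> in at_right 0. \<Psi>1 C \<delta> \<le> ?K * \<Psi>0 \<delta> powr (qh * s / (1 + (qh - 1) * s))"
      proof eventually_elim
        case (elim \<delta>)
        have "(INF l\<in>{1..}. a l + b l * \<Psi>0 \<delta>)
            \<le> (N powr qh + 2 powr (1 - s) * N) * \<Psi>0 \<delta> powr (qh * s / (1 + (qh - 1) * s))"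
          unfolding a_def b_def using elim N \<Psi>0_pos[of \<delta>] by (intro INF_rate_le s hat) auto
        then show ?case
          using False C_pos unfolding \<Psi>1_def by (simp add: mult.assoc)
      qed
      moreover have "0 < ?K"
        using C_pos N by (intro mult_pos_pos add_pos_pos) auto
      ultimately show ?thesis by blast
    qed
    ultimately show ?thesis by blast
  qed
  moreover have "(if s = 1 then C * F_norm q M P \<theta> f * \<Psi>0 \<delta>
      else C * (INF l\<in>{1::real..}. 1 / 2 powr (l * qh * s) * F_norm q M P (s * \<theta>) f powr qh
        + 2 powr ((l + 1) * (1 - s)) * F_norm q M P (s * \<theta>) f * \<Psi>0 \<delta>)) = \<Psi>1 C \<delta>" for C \<delta>
    unfolding \<Psi>1_def a_def b_def N_def by simp
  moreover have "0 < C0"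
    using K0(1) unfolding C0_def by simp
  ultimately show ?thesis
    unfolding Let_def f_def[symmetric] \<open>fdag = _\<close>[symmetric] by auto
qed

end
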